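(* Let $k\geq 1$ be an integer. Let $G_1,\ldots,G_k$ be connected graphs of order at least $2$ with minimum degrees $d_1,\ldots,d_k$, respectively, and let $H$ be a connected graph with maximum degree $\Delta(H)=\sum_{i=1}^{k} d_i$. Assume that the following conditions hold: (1) if $k=1$, then $H$ is not isomorphic to $G_1$; (2) if $G_i$ is isomorphic to $K_{d_i+1}$ for every $1\leq i\leq k$, then $H$ is not isomorphic to $K_{\Delta(H)+1}$; (3) if $G_i$ is isomorphic to $K_2$ for every $1\leq i\leq k$, then $H$ is neither an odd cycle nor a complete graph. Then there is a partition of $V(H)$ into sets $V_1,\ldots,V_k$ such that $H[V_i]$ is $G_i$-free for every $1\leq i\leq k$, and moreover the partition can be chosen so that, for some $i$, $H[V_i]$ is a maximum induced $G_i$-free subgraph of $H$ (that is, $V_i$ has the largest cardinality among all sets $W\subseteq V(H)$ such that $H[W]$ is $G_i$-free).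
   Context: All graphs are finite and simple. $H[W]$ denotes the subgraph of $H$ induced on $W\subseteq V(H)$. A graph is $G$-free if it contains no subgraph (not necessarily induced) isomorphic to $G$. $K_n$ is the complete graph on $n$ vertices. The classes of a partition are pairwise disjoint with union $V(H)$; classes are allowed to be empty (as color classes of a coloring with $k$ colors). *)

theory Defs
  imports
    "Graph_Theory.Digraph_Isomorphism"
    "Graph_Theory.Kuratowski"
    "HOL-Library.Disjoint_Sets"
begin

text \<open>
  Finite simple graphs are the symmetric, loop-free digraphs without parallel arcs of the
  locale \<open>graph\<close>: an undirected edge is a pair of opposite arcs. Hence the degree of a
  vertex is its out-degree (equal to its in-degree), and not the sum of the two.
\<close>

definition min_degree :: "('a, 'b) pre_digraph \<Rightarrow> nat" where
  "min_degree G = Min (out_degree G ` verts G)"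

definition max_degree :: "('a, 'b) pre_digraph \<Rightarrow> nat" where
  "max_degree G = Max (out_degree G ` verts G)"

text \<open>
  The predicate \<open>subgraph\<close> also admits non-symmetric subdigraphs; here these are ruled out
  by the isomorphism whenever \<open>G\<close> is a graph.
\<close>

definition subgraph_free :: "('b, 'c) pre_digraph \<Rightarrow> ('a, 'd) pre_digraph \<Rightarrow> bool" where
  "subgraph_free G H \<longleftrightarrow> \<not> (\<exists>S. subgraph S H \<and> digraph_iso S G)"

definition cycle_graph :: "nat \<Rightarrow> nat pair_pre_digraph" where
  "cycle_graph n =
    \<lparr> pverts = {..<n},
      parcs = {(i, j). i < n \<and> j < n \<and> (j = Suc i mod n \<or> i = Suc j mod n)} \<rparr>"

definition is_odd_cycle :: "('a, 'b) pre_digraph \<Rightarrow> bool" where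
  "is_odd_cycle G \<longleftrightarrow> (\<exists>n\<ge>3. odd n \<and> digraph_iso G (with_proj (cycle_graph n)))"

text \<open>\<open>W\<close> is a largest vertex set inducing a \<open>G\<close>-free subgraph of \<open>H\<close>.\<close>

definition max_induced_free ::
  "('b, 'c) pre_digraph \<Rightarrow> ('a, 'd) pre_digraph \<Rightarrow> 'a set \<Rightarrow> bool" where
  "max_induced_free G H W \<longleftrightarrow>
    W \<subseteq> verts H \<and> subgraph_free G (H \<restriction> W) \<and>
    (\<forall>U. U \<subseteq> verts H \<and> subgraph_free G (H \<restriction> U) \<longrightarrow> card U \<le> card W)"

end

theory Submission
  imports Defs
begin

text \<open>
  Let \<open>U\<close> be a largest vertex set inducing a \<open>G\<^sub>1\<close>-free subgraph and let \<open>W\<close> be, given the size of \<open>U\<close>,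
  a largest disjoint set that can be partitioned for \<open>G\<^sub>2, \<dots>, G\<^sub>k\<close>. A vertex \<open>x\<close> left over (a
  \<^emph>\<open>joker\<close>) cannot be added to either set, so by the bound on the maximum degree it has exactly
  \<open>a = d\<^sub>1\<close> neighbours in \<open>U\<close> and \<open>b = d\<^sub>2 + \<dots> + d\<^sub>k\<close> in \<open>W\<close>, and it can be exchanged with any of its
  neighbours. Hence the component of the joker in \<open>U \<union> {x}\<close> is \<open>a\<close>-regular and the one in \<open>W \<union> {x}\<close>
  is \<open>b\<close>-regular. Let the joker walk through the graph, moving alternately within both sides and
  always to a non-cut vertex of its current component. At the first moment when a component meets
  the remainder of an earlier one, regularity forces two vertices to be twins, and further exchanges
  force \<open>H\<close> to be complete, unless \<open>a = b = 1\<close>, where the walk closes up to an odd cycle. In both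
  cases the left-over vertex shows that every \<open>G\<^sub>i\<close> is complete, which the hypotheses exclude. If
  \<open>k = 1\<close> and \<open>H\<close> contains \<open>G\<^sub>1\<close>, then by the degrees this copy is all of \<open>H\<close>.
\<close>


section \<open>Connectivity, components and degrees inside a vertex set\<close>

locale finite_graph =
  fixes V :: "'a set" and E :: "'a \<Rightarrow> 'a \<Rightarrow> bool"
  assumes finite_V: "finite V"
    and adj_in: "E x y \<Longrightarrow> x \<in> V \<and> y \<in> V"
    and adj_sym: "E x y \<Longrightarrow> E y x"
    and adj_irrefl: "\<not> E x x"
begin

definition dg :: "'a \<Rightarrow> 'a set \<Rightarrow> nat" where
  "dg x A = card {y \<in> A. E x y}"

text \<open>Connectedness in cut form: no walks are needed, and a cut yields an edge at once. The
  empty set and singletons count as connected.\<close>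

definition conn :: "'a set \<Rightarrow> bool" where
  "conn K \<longleftrightarrow> (\<forall>S. S \<noteq> {} \<and> S \<subset> K \<longrightarrow> (\<exists>u\<in>S. \<exists>z\<in>K - S. E u z))"

inductive_set component :: "'a set \<Rightarrow> 'a \<Rightarrow> 'a set" for A :: "'a set" and v :: 'a where
  base: "v \<in> component A v"
| step: "u \<in> component A v \<Longrightarrow> z \<in> A \<Longrightarrow> E u z \<Longrightarrow> z \<in> component A v"

lemma component_subset: "v \<in> A \<Longrightarrow> component A v \<subseteq> A"
proof
  fix u assume "v \<in> A" "u \<in> component A v"
  from this(2,1) show "u \<in> A" by induction auto
qed

lemma connD: "conn K \<Longrightarrow> S \<noteq> {} \<Longrightarrow> S \<subset> K \<Longrightarrow> \<exists>u\<in>S. \<exists>z\<in>K - S. E u z"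
  by (simp add: conn_def)

lemma conn_subset_closed:
  assumes "conn D" "D \<inter> C \<noteq> {}" "\<And>u z. u \<in> D \<Longrightarrow> u \<in> C \<Longrightarrow> z \<in> D \<Longrightarrow> E u z \<Longrightarrow> z \<in> C"
  shows "D \<subseteq> C"
  using connD[OF assms(1), of "D \<inter> C"] assms(2,3) by blast

lemma component_minimal:
  assumes "v \<in> S" "\<And>u z. u \<in> S \<Longrightarrow> z \<in> A \<Longrightarrow> E u z \<Longrightarrow> z \<in> S"
  shows "component A v \<subseteq> S"
proof
  fix u assume "u \<in> component A v"
  then show "u \<in> S" by induction (use assms in auto)
qed

text \<open>If a part \<open>S\<close> without outgoing edges contains \<open>v\<close>, it is
  closed and hence the whole component; otherwise its complement in the component contains
  \<open>v\<close> and is closed by symmetry of \<open>E\<close>.\<close>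

lemma conn_component:
  assumes "v \<in> A" shows "conn (component A v)"
  unfolding conn_def
proof (intro allI impI, rule ccontr)
  fix S assume S: "S \<noteq> {} \<and> S \<subset> component A v"
    and "\<not> (\<exists>u\<in>S. \<exists>z\<in>component A v - S. E u z)"
  then have no: "\<not> E u z" if "u \<in> S" "z \<in> component A v" "z \<notin> S" for u z
    using that by auto
  show False
  proof (cases "v \<in> S")
    case True
    have "z \<in> S" if "u \<in> S" "z \<in> A" "E u z" for u z
    proof -
      have "u \<in> component A v" using S that(1) by auto
      from component.step[OF this that(2,3)] no[OF that(1)] that(3) show ?thesis by auto
    qed
    then have "component A v \<subseteq> S" by (rule component_minimal[OF True])
    then show False using S by auto
  next
    case False
    have "z \<in> component A v - S" if "u \<in> component A v - S" "z \<in> A" "E u z" for u z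
    proof -
      have "z \<in> component A v" using component.step[of u A v z] that by auto
      moreover have "z \<notin> S" using no[of z u] adj_sym[OF that(3)] that(1) by auto
      ultimately show ?thesis by auto
    qed
    then have "component A v \<subseteq> component A v - S"
      by (rule component_minimal[rotated]) (auto simp: False intro: component.base)
    then show False using S by auto
  qed
qed

lemma conn_subset_component:
  assumes "conn D" "D \<subseteq> A" "D \<inter> component A v \<noteq> {}"
  shows "D \<subseteq> component A v"
proof (rule conn_subset_closed[OF assms(1,3)])
  fix u z assume "u \<in> component A v" "z \<in> D" "E u z"
  then show "z \<in> component A v" using assms(2) component.step[of u A v z] by blast
qed

lemma conn_insert:
  assumes "conn S" "u \<in> S" "E u z"
  shows "conn (insert z S)"
  unfolding conn_def
proof (intro allI impI)
  fix T assume T: "T \<noteq> {} \<and> T \<subset> insert z S"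
  show "\<exists>u\<in>T. \<exists>y\<in>insert z S - T. E u y"
  proof (cases "z \<in> S")
    case True
    then show ?thesis using connD[OF assms(1), of T] T by (simp add: insert_absorb)
  next
    case zS: False
    show ?thesis
    proof (cases "T - {z} = {} \<or> T - {z} = S")
      case True
      then show ?thesis
      proof
        assume "T - {z} = {}"
        then have "T = {z}" using T by blast
        then show ?thesis using assms(2) adj_sym[OF assms(3)] zS by auto
      next
        assume "T - {z} = S"
        then have "T = S" using T by blast
        then show ?thesis using assms(2,3) zS by auto
      qed
    next
      case False
      then have ne: "T - {z} \<noteq> {}" and "T - {z} \<subseteq> S" and "T - {z} \<noteq> S" using T by auto
      then have "T - {z} \<subset> S" by simp
      from connD[OF assms(1) ne this]
      obtain a b where "a \<in> T - {z}" "b \<in> S - (T - {z})" "E a b" by auto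
      then show ?thesis using zS by auto
    qed
  qed
qed

text \<open>A largest connected proper subset of \<open>K\<close> that contains \<open>v\<close> misses only one vertex.\<close>

lemma ex_noncut_vertex:
  assumes "finite K" "conn K" "v \<in> K" "K \<noteq> {v}"
  shows "\<exists>u\<in>K. u \<noteq> v \<and> conn (K - {u})"
proof -
  let ?C = "{S. conn S \<and> v \<in> S \<and> S \<subset> K}"
  have "conn {v}" unfolding conn_def by auto
  then have "{v} \<in> ?C" using assms by auto
  moreover have "\<forall>S. S \<in> ?C \<longrightarrow> card S < card K"
    using assms(1) by (auto intro!: psubset_card_mono)
  ultimately have "\<exists>S. S \<in> ?C \<and> (\<forall>T. T \<in> ?C \<longrightarrow> card T \<le> card S)"
    by (rule ex_has_greatest_nat)
  then obtain S where S: "S \<in> ?C" and max: "\<And>T. T \<in> ?C \<Longrightarrow> card T \<le> card S"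
    by blast
  obtain u z where uz: "u \<in> S" "z \<in> K - S" "E u z"
    using connD[OF assms(2), of S] S by blast
  have "conn (insert z S)" by (rule conn_insert[of S u z]) (use S uz in auto)
  have "insert z S = K"
  proof (rule ccontr)
    assume "insert z S \<noteq> K"
    then have "insert z S \<in> ?C" using S uz \<open>conn (insert z S)\<close> by blast
    then have "card (insert z S) \<le> card S" by (rule max)
    moreover have "finite S" using S assms(1) finite_subset by blast
    ultimately show False using uz by simp
  qed
  then have "K - {z} = S" using uz(2) by auto
  have Sc: "conn S" and vS: "v \<in> S" using S by simp_all
  have "conn (K - {z})" unfolding \<open>K - {z} = S\<close> by (rule Sc)
  moreover have "z \<noteq> v" using vS uz(2) by auto
  moreover have "z \<in> K" using uz(2) by simp
  ultimately show ?thesis by auto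
qed

lemma finite_nbrs [simp]: "finite {y \<in> A. E x y}"
proof (rule finite_subset[OF _ finite_V])
  show "{y \<in> A. E x y} \<subseteq> V" by (auto dest: adj_in)
qed

lemma dg_insert:
  assumes "y \<notin> A"
  shows "dg x (insert y A) = dg x A + of_bool (E x y)"
proof (cases "E x y")
  case True
  have "{z \<in> insert y A. E x z} = insert y {z \<in> A. E x z}" using True by auto
  then show ?thesis using True assms by (simp add: dg_def)
next
  case False
  then have "{z \<in> insert y A. E x z} = {z \<in> A. E x z}" by auto
  then show ?thesis using False by (simp add: dg_def)
qed

lemma dg_remove:
  assumes "y \<in> A"
  shows "dg x A = dg x (A - {y}) + of_bool (E x y)"
proof -
  have "insert y (A - {y}) = A" using assms by auto
  then show ?thesis using dg_insert[of y "A - {y}" x] by simp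
qed

lemma dg_cong:
  assumes "\<And>y. E x y \<Longrightarrow> y \<in> A \<longleftrightarrow> y \<in> B"
  shows "dg x A = dg x B"
proof -
  have "{y \<in> A. E x y} = {y \<in> B. E x y}" using assms by auto
  then show ?thesis by (simp add: dg_def)
qed

lemma dg_mono:
  assumes "A \<subseteq> B"
  shows "dg x A \<le> dg x B"
proof -
  have "{y \<in> A. E x y} \<subseteq> {y \<in> B. E x y}" using assms by auto
  then show ?thesis unfolding dg_def by (rule card_mono[OF finite_nbrs])
qed

lemma dg_Un:
  assumes "A \<inter> B = {}"
  shows "dg x (A \<union> B) = dg x A + dg x B"
proof -
  have "{y \<in> A \<union> B. E x y} = {y \<in> A. E x y} \<union> {y \<in> B. E x y}" by auto
  moreover have "{y \<in> A. E x y} \<inter> {y \<in> B. E x y} = {}" using assms by auto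
  ultimately show ?thesis by (simp add: dg_def card_Un_disjoint)
qed

end

context finite_graph
begin

definition clique :: "'a set \<Rightarrow> bool" where
  "clique C \<longleftrightarrow> (\<forall>x\<in>C. \<forall>y\<in>C. x \<noteq> y \<longrightarrow> E x y)"

lemma component_mono: "A \<subseteq> B \<Longrightarrow> component A v \<subseteq> component B v"
  by (rule component_minimal) (auto intro: component.intros)

lemma component_trans:
  assumes "y \<in> component A x" shows "component A y \<subseteq> component A x"
  by (rule component_minimal[OF assms]) (auto intro: component.step)

lemma component_sym:
  assumes "x \<in> A" "y \<in> component A x" shows "x \<in> component A y"
  using assms(2)
proof induction
  case base
  then show ?case by (rule component.base)
next
  case (step u z)
  have "u \<in> A" using component_subset[OF assms(1)] step.hyps(1) by auto
  then have "u \<in> component A z"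
    using component.step[OF component.base, of u A z] adj_sym[OF step.hyps(3)] by simp
  from component_trans[OF this] step.IH show ?case by auto
qed

lemma component_eq:
  assumes "x \<in> A" "y \<in> component A x" shows "component A y = component A x"
  using component_trans[OF assms(2)] component_trans[OF component_sym[OF assms]] by auto

end

section \<open>Exchanges of the joker and the twin argument\<close>

text \<open>\<open>Q A B r s x\<close> stands for two maximal sides \<open>A - {x}\<close> and \<open>B\<close> that leave out the joker \<open>x\<close>,
  which has \<open>r\<close> neighbours in \<open>A\<close> and \<open>s\<close> in \<open>B\<close>. By \<open>Q_step\<close> the joker may be exchanged with a
  neighbour in \<open>A\<close>; \<open>Q_flip\<close> swaps the roles of the sides.\<close>

locale joker = finite_graph +
  fixes Q :: "'a set \<Rightarrow> 'a set \<Rightarrow> nat \<Rightarrow> nat \<Rightarrow> 'a \<Rightarrow> bool"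
  assumes conn_V: "conn V"
    and Q_mem: "Q A B r s x \<Longrightarrow> x \<in> A"
    and Q_disj: "Q A B r s x \<Longrightarrow> A \<inter> B = {}"
    and Q_sub: "Q A B r s x \<Longrightarrow> A \<union> B \<subseteq> V"
    and Q_dg: "Q A B r s x \<Longrightarrow> dg x A = r"
    and Q_dgV: "Q A B r s x \<Longrightarrow> dg x V \<le> r + s"
    and Q_step: "Q A B r s x \<Longrightarrow> y \<in> A \<Longrightarrow> E x y \<Longrightarrow> Q A B r s y"
    and Q_flip: "Q A B r s x \<Longrightarrow> Q (insert x B) (A - {x}) s r x"
begin

text \<open>Each edge of the component is one exchange. Together with \<open>Q_dg\<close> this makes
  the component of the joker \<open>r\<close>-regular, the source of the later degree
  comparisons.\<close>

lemma Q_component: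
  assumes "Q A B r s x" "y \<in> component A x"
  shows "Q A B r s y"
  using assms(2) by induction (use assms(1) Q_step in auto)

lemma Q_dg_B:
  assumes "Q A B r s x" shows "dg x B = s"
proof -
  have "x \<notin> B" using Q_mem[OF assms] Q_disj[OF assms] by auto
  then show ?thesis using Q_dg[OF Q_flip[OF assms]] dg_insert[of x B x] adj_irrefl[of x] by simp
qed

lemma closed_eq_V:
  assumes "C \<noteq> {}" "C \<subseteq> V" "\<And>x y. x \<in> C \<Longrightarrow> E x y \<Longrightarrow> y \<in> C"
  shows "C = V"
proof (rule ccontr)
  assume "C \<noteq> V"
  then have "C \<subset> V" using assms(2) by auto
  from connD[OF conn_V assms(1) this] show False using assms(3) by auto
qed

lemma nbrs_eq:
  assumes "dg x V \<le> card S" "\<And>y. y \<in> S \<Longrightarrow> E x y"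
  shows "E x y \<longleftrightarrow> y \<in> S"
proof -
  have sub: "S \<subseteq> {y \<in> V. E x y}" using assms(2) adj_in by auto
  have "S = {y \<in> V. E x y}"
    by (rule card_seteq[OF finite_nbrs sub]) (use assms(1) in \<open>simp add: dg_def\<close>)
  then show ?thesis using adj_in by auto
qed

text \<open>Every vertex of \<open>C\<close> has \<open>card C - 1\<close> neighbours inside the
  clique already, so the degree bound leaves no edge out of \<open>C\<close>, and connectedness of
  \<open>V\<close> finishes.\<close>

lemma clique_eq_V:
  assumes "clique C" "C \<subseteq> V" "C \<noteq> {}" "\<And>x. x \<in> C \<Longrightarrow> dg x V < card C"
  shows "C = V"
proof (rule closed_eq_V[OF assms(3,2)])
  fix x y assume x: "x \<in> C" and "E x y"
  have "finite C" using assms(2) finite_V finite_subset by auto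
  then have "dg x V \<le> card (C - {x})" using assms(4)[OF x] x by (simp add: card_Diff_singleton)
  moreover have "E x z" if "z \<in> C - {x}" for z using that assms(1) x by (auto simp: clique_def)
  ultimately have "y \<in> C - {x}" using nbrs_eq[of x "C - {x}" y] \<open>E x y\<close> by simp
  then show "y \<in> C" by simp
qed

text \<open>If a vertex \<open>w\<close> of the other side is adjacent to all neighbours of the joker \<open>v\<close> in its own
  side, then moving the joker around shows that \<open>w\<close> and \<open>v\<close> are adjacent and that the neighbours
  of \<open>v\<close> on both sides form a clique, which is all of \<open>V\<close>.\<close>

lemma clique_from_twin:
  assumes Q: "Q A B r s v" and w: "w \<in> B" and r: "2 \<le> r"
    and twin: "\<And>u. u \<in> A \<Longrightarrow> E v u \<Longrightarrow> E u w"
    and noncut: "conn (component (insert v B) v - {v})"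
  shows "clique V \<and> card V = r + s + 1"
proof -
  define N where "N = {u \<in> A. E v u}"
  define M where "M = {u \<in> B. E v u}"
  have cN: "card N = r" using Q_dg[OF Q] by (simp add: N_def dg_def)
  have cM: "card M = s" using Q_dg_B[OF Q] by (simp add: M_def dg_def)
  have vA: "v \<in> A" and disj: "A \<inter> B = {}" using Q_mem[OF Q] Q_disj[OF Q] by auto
  have wA: "w \<notin> A" and vB: "v \<notin> B" using w vA disj by auto
  have QN: "Q A B r s u" if "u \<in> N" for u using that Q_step[OF Q] by (simp add: N_def)
  have QB: "Q (insert v B) (A - {v}) s r v" by (rule Q_flip[OF Q])
  have QM: "Q (insert v B) (A - {v}) s r m" if "m \<in> M" for m
    using that Q_step[OF QB] by (simp add: M_def)
  \<comment> \<open>The joker goes from \<open>v\<close> to \<open>u\<close>, across to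
    \<open>w\<close> and back to \<open>u'\<close>. In the new side \<open>w\<close> stands in for
    \<open>u\<close>; as \<open>u'\<close> is adjacent to \<open>w\<close> and still has degree
    \<open>r\<close>, only \<open>r - 1\<close> of its neighbours lie in \<open>A - {u}\<close>, and
    \<open>u\<close> itself must be the missing one.\<close>
  have move: "Q (insert w (A - {u})) (insert u B - {w}) r s u'" "dg u' (A - {u}) + 1 = r"
    if u: "u \<in> N" "u' \<in> N" "u \<noteq> u'" for u u'
  proof -
    have Euw: "E u w" "E u' w" using u twin by (auto simp: N_def)
    have "Q (insert u B) (A - {u}) s r w"
      by (rule Q_step[OF Q_flip[OF QN[OF u(1)]]]) (use w Euw in auto)
    from Q_flip[OF this] have "Q (insert w (A - {u})) (insert u B - {w}) r s w" .
    then show *: "Q (insert w (A - {u})) (insert u B - {w}) r s u'"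
      by (rule Q_step) (use u adj_sym[OF Euw(2)] in \<open>auto simp: N_def\<close>)
    show "dg u' (A - {u}) + 1 = r"
      using Q_dg[OF *] dg_insert[of w "A - {u}" u'] wA Euw(2) by simp
  qed
  have clN: "E u' u" if u: "u \<in> N" "u' \<in> N" "u \<noteq> u'" for u u'
  proof -
    have "dg u' A = dg u' (A - {u}) + of_bool (E u' u)"
      by (rule dg_remove) (use u in \<open>simp add: N_def\<close>)
    then show ?thesis using Q_dg[OF QN[OF u(2)]] move(2)[OF u] by (cases "E u' u") auto
  qed
  obtain u u' where u: "u \<in> N" "u' \<in> N" "u \<noteq> u'"
  proof -
    have "finite N" by (simp add: N_def)
    then have "\<exists>u\<in>N. \<exists>u'\<in>N. u \<noteq> u'"
      using cN r card_le_Suc0_iff_eq[of N] by auto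
    then show ?thesis using that by auto
  qed
  have uv: "E v u" "E u v" "E u' v" "u \<noteq> v"
    using u adj_sym[of v] adj_irrefl[of v] by (auto simp: N_def)
  \<comment> \<open>From \<open>u'\<close> the joker returns to \<open>v\<close>. There
    \<open>v\<close> has lost the neighbour \<open>u\<close> but still has degree \<open>r\<close>,
    so the newcomer \<open>w\<close> must be adjacent to it.\<close>
  have "Q (insert w (A - {u})) (insert u B - {w}) r s v"
    by (rule Q_step[OF move(1)[OF u]]) (use vA uv in auto)
  from Q_dg[OF this] have "dg v (A - {u}) + of_bool (E v w) = r"
    using dg_insert[of w "A - {u}" v] wA by simp
  moreover have "dg v A = dg v (A - {u}) + of_bool (E v u)"
    by (rule dg_remove) (use u in \<open>simp add: N_def\<close>)
  ultimately have vw: "E v w" using Q_dg[OF Q] uv(1) by (cases "E v w") auto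
  \<comment> \<open>Each such joker \<open>t\<close> can cross to \<open>w\<close> and wander
    through the same component of \<open>B\<close>. So whether \<open>x\<close> is adjacent to
    \<open>t\<close> is determined by the degree of \<open>x\<close> in \<open>B\<close>, and is the
    same for \<open>v\<close> and for all of \<open>N\<close>.\<close>
  have dgX: "dg x B + of_bool (E x t) = s" if "t = v \<or> t \<in> N" "x \<in> component B w" for t x
  proof -
    have Qt: "Q A B r s t" using that(1) Q QN by auto
    have tB: "t \<notin> B" using that(1) vB disj by (auto simp: N_def)
    have "E t w" using that(1) vw twin by (auto simp: N_def)
    then have "Q (insert t B) (A - {t}) s r w"
      by (intro Q_step[OF Q_flip[OF Qt]]) (use w in auto)
    moreover have "x \<in> component (insert t B) w"
      using that(2) component_mono[of B "insert t B" w] by auto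
    ultimately have "Q (insert t B) (A - {t}) s r x" by (rule Q_component)
    from Q_dg[OF this] show ?thesis using dg_insert[OF tB, of x] by simp
  qed
  \<comment> \<open>Since \<open>v\<close> is not a cut vertex of its component in
    \<open>insert v B\<close>, its neighbours in \<open>B\<close>, among them \<open>w\<close>, stay
    connected to each other once \<open>v\<close> is removed.\<close>
  have MX: "M \<subseteq> component B w"
  proof -
    let ?D = "component (insert v B) v - {v}"
    have sub: "m \<in> ?D" if "m \<in> B" "E v m" for m
      using that component.step[OF component.base, of m "insert v B" v] vB by auto
    have "?D \<subseteq> component B w"
    proof (rule conn_subset_component[OF noncut])
      show "?D \<subseteq> B" using component_subset[of v "insert v B"] by auto
      show "?D \<inter> component B w \<noteq> {}" using sub[OF w vw] component.base by auto
    qed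
    then show ?thesis using sub by (auto simp: M_def)
  qed
  have NM: "E m t" if "m \<in> M" "t \<in> N" for m t
  proof -
    have m: "m \<in> component B w" using MX that(1) by auto
    have "E m v" using that(1) adj_sym by (auto simp: M_def)
    then show ?thesis using dgX[of v m] dgX[of t m] m that(2) by (cases "E m t") auto
  qed
  \<comment> \<open>The mirror image of \<open>move\<close>: the joker goes from \<open>v\<close> to
    \<open>m\<close>, across to \<open>u\<close> and back to \<open>m'\<close>, so that
    \<open>u\<close> stands in for \<open>m\<close>.\<close>
  have clM: "E m' m" if m: "m \<in> M" "m' \<in> M" "m \<noteq> m'" for m m'
  proof -
    have mB: "m \<in> B" "m' \<in> B" "m \<notin> A" using m disj by (auto simp: M_def)
    have "Q (insert m (A - {v})) (insert v B - {m}) r s u"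
      by (rule Q_step[OF Q_flip[OF QM[OF m(1)]]]) (use u uv NM[OF m(1) u(1)] in \<open>auto simp: N_def\<close>)
    from Q_flip[OF this]
    have "Q (insert u (insert v B - {m})) (insert m (A - {v}) - {u}) s r m'"
      by (rule Q_step) (use mB m adj_sym[OF NM[OF m(2) u(1)]] in auto)
    note dg = Q_dg[OF this]
    have "u \<notin> insert v B - {m}" using u(1) uv(4) disj by (auto simp: N_def)
    from dg_insert[OF this, of m'] dg have "dg m' (insert v B - {m}) + 1 = s"
      using NM[OF m(2) u(1)] by simp
    moreover have "dg m' (insert v B) = dg m' (insert v B - {m}) + of_bool (E m' m)"
      by (rule dg_remove) (use mB in simp)
    ultimately show ?thesis using Q_dg[OF QM[OF m(2)]] by (cases "E m' m") auto
  qed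
  define C where "C = insert v (N \<union> M)"
  have "N \<inter> M = {}" using disj by (auto simp: N_def M_def)
  moreover have "v \<notin> N \<union> M" using adj_irrefl by (auto simp: N_def M_def)
  ultimately have cC: "card C = r + s + 1"
    using cN cM by (simp add: C_def card_Un_disjoint N_def M_def)
  have "E v x" "E x v" if "x \<in> N \<union> M" for x
    using that adj_sym[of v x] by (auto simp: N_def M_def)
  moreover have "E t m" if "m \<in> M" "t \<in> N" for m t by (rule adj_sym[OF NM[OF that]])
  ultimately have clC: "clique C"
    using clN clM NM unfolding clique_def C_def by auto
  have "C = V"
  proof (rule clique_eq_V[OF clC])
    show "C \<subseteq> V" using Q_sub[OF Q] vA by (auto simp: C_def N_def M_def)
    show "dg x V < card C" if "x \<in> C" for x
      using that Q_dgV[OF Q] Q_dgV[OF QN, of x] Q_dgV[OF QM, of x] cC by (auto simp: C_def)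
  qed (simp add: C_def)
  then show ?thesis using clC cC by simp
qed

end

section \<open>The walk of the joker and its first overlap\<close>

text \<open>The joker moves to a non-cut vertex of its component and then changes sides, and so on.\<close>

locale joker_walk = joker +
  fixes A B :: "nat \<Rightarrow> 'a set" and v :: "nat \<Rightarrow> 'a" and \<rho> :: "nat \<Rightarrow> nat"
  assumes Q_walk: "Q (A n) (B n) (\<rho> n) (\<rho> (Suc n)) (v n)"
    and \<rho>_pos: "1 \<le> \<rho> n"
    and \<rho>_period: "\<rho> (Suc (Suc n)) = \<rho> n"
    and v_Suc: "v (Suc n) \<in> component (A n) (v n)" "v (Suc n) \<noteq> v n"
    and noncut: "conn (component (A n) (v n) - {v (Suc n)})"
    and A_Suc: "A (Suc n) = insert (v (Suc n)) (B n)"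
    and B_Suc: "B (Suc n) = A n - {v (Suc n)}"
begin

abbreviation K :: "nat \<Rightarrow> 'a set" where "K n \<equiv> component (A n) (v n)"
definition D :: "nat \<Rightarrow> 'a set" where "D n = K n - {v (Suc n)}"

text \<open>The sides alternate, so only times of equal parity concern the same side;
  \<open>Suc j\<close> excludes comparing time \<open>i\<close> with itself.\<close>

definition overlap :: "nat \<Rightarrow> nat \<Rightarrow> bool" where
  "overlap i j \<longleftrightarrow> K (i + 2 * Suc j) \<inter> D i \<noteq> {}"

lemma v_in_A: "v n \<in> A n" by (rule Q_mem[OF Q_walk])
lemma v_in_K: "v n \<in> K n" by (rule component.base)
lemma v_in_D: "v n \<in> D n" using v_Suc(2)[of n] v_in_K[of n] by (auto simp: D_def)
lemma D_sub: "D n \<subseteq> K n" by (auto simp: D_def)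
lemma conn_D: "conn (D n)" unfolding D_def by (rule noncut)
lemma K_sub: "K n \<subseteq> A n" by (rule component_subset[OF v_in_A])
lemma A_sub: "A n \<subseteq> V" using Q_sub[OF Q_walk[of n]] by auto
lemma A_B_disj: "A n \<inter> B n = {}" by (rule Q_disj[OF Q_walk])
lemma v_notin_B: "v (Suc n) \<notin> B n" using v_Suc(1)[of n] K_sub[of n] A_B_disj[of n] by auto

lemma \<rho>_add: "\<rho> (i + 2 * j) = \<rho> i"
  by (induction j) (simp_all add: \<rho>_period)

lemma K_closed: "u \<in> K n \<Longrightarrow> z \<in> A n \<Longrightarrow> E u z \<Longrightarrow> z \<in> K n"
  by (rule component.step)

text \<open>Until it is overlapped, what is left of a visited component stays a union of components of its
  side.\<close>

lemma persist:
  assumes "\<forall>j'<j. \<not> overlap i j'"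
  shows "D i \<subseteq> B (Suc i + 2 * j) \<and>
    (\<forall>u\<in>D i. \<forall>z\<in>B (Suc i + 2 * j). E u z \<longrightarrow> z \<in> D i)"
  using assms
proof (induction j)
  case 0
  have eq: "B (Suc i + 2 * 0) = A i - {v (Suc i)}" by (simp add: B_Suc)
  have "D i \<subseteq> A i - {v (Suc i)}" using K_sub[of i] by (auto simp: D_def)
  moreover have "z \<in> D i" if "u \<in> D i" "z \<in> A i - {v (Suc i)}" "E u z" for u z
    using K_closed[of u i z] that unfolding D_def by simp
  ultimately show ?case unfolding eq by simp
next
  case (Suc j)
  let ?n = "Suc i + 2 * j"
  have IH: "D i \<subseteq> B ?n" "\<And>u z. u \<in> D i \<Longrightarrow> z \<in> B ?n \<Longrightarrow> E u z \<Longrightarrow> z \<in> D i"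
    using Suc.IH Suc.prems by simp_all
  have eq: "Suc i + 2 * Suc j = Suc (Suc ?n)" "i + 2 * Suc j = Suc ?n" by simp_all
  have "\<not> overlap i j" using Suc.prems by simp
  then have dis: "K (Suc ?n) \<inter> D i = {}" unfolding overlap_def eq(2) by simp
  \<comment> \<open>In two steps the side gains one vertex and loses one, both from
    \<open>K (Suc ?n)\<close>, which misses \<open>D i\<close>.\<close>
  have Bn: "B (Suc (Suc ?n)) = insert (v (Suc ?n)) (B ?n) - {v (Suc (Suc ?n))}"
    unfolding B_Suc[of "Suc ?n"] A_Suc[of ?n] ..
  have noadj: "\<not> E u (v (Suc ?n))" if "u \<in> D i" for u
  proof
    assume "E u (v (Suc ?n))"
    moreover have "u \<in> A (Suc ?n)" using that IH(1) unfolding A_Suc by auto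
    ultimately have "u \<in> K (Suc ?n)"
      using K_closed[OF v_in_K, of u "Suc ?n"] adj_sym[of u] by simp
    then show False using dis that by auto
  qed
  have notin: "v (Suc (Suc ?n)) \<notin> D i" using v_Suc(1)[of "Suc ?n"] dis D_sub by auto
  have "D i \<subseteq> B (Suc (Suc ?n))" unfolding Bn using IH(1) notin by auto
  moreover have "z \<in> D i" if "u \<in> D i" "z \<in> B (Suc (Suc ?n))" "E u z" for u z
  proof -
    have "z \<noteq> v (Suc ?n)" using noadj[OF that(1)] that(3) by auto
    then have "z \<in> B ?n" using that(2) unfolding Bn by auto
    then show ?thesis using IH(2)[OF that(1) _ that(3)] by simp
  qed
  ultimately show ?case unfolding eq(1) by simp
qed

lemma persist_notin:
  assumes "\<forall>j'<j. \<not> overlap i j'"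
  shows "v (i + 2 * Suc j) \<notin> D i"
proof -
  have "i + 2 * Suc j = Suc (Suc i + 2 * j)" by simp
  then show ?thesis using persist[OF assms] v_notin_B[of "Suc i + 2 * j"] by auto
qed

text \<open>At the first overlap the connected set \<open>D i\<close> is swallowed by
  \<open>K m\<close>. A vertex of \<open>D i\<close> has the same degree now as at time
  \<open>i\<close>, and around it the only change is that \<open>v m\<close> has taken the place of
  \<open>v (Suc i)\<close>, so it is adjacent to both or to neither. Hence the neighbours of
  \<open>v (Suc i)\<close> in \<open>D i\<close> are neighbours of \<open>v m\<close> too; they
  already number \<open>\<rho> i\<close>, which leaves no others in \<open>A m\<close>.\<close>

lemma first_overlap:
  assumes no: "\<forall>j'<j. \<not> overlap i j'" and ov: "overlap i j"
  defines "m \<equiv> i + 2 * Suc j"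
  shows "D i \<subseteq> K m" "\<And>u. u \<in> D i \<Longrightarrow> E u (v m) \<longleftrightarrow> E u (v (Suc i))"
    "\<And>u. u \<in> A m \<Longrightarrow> E (v m) u \<Longrightarrow> u \<in> D i"
proof -
  let ?w = "v (Suc i)" and ?n = "Suc i + 2 * j"
  have mn: "m = Suc ?n" by (simp add: m_def)
  have sub: "D i \<subseteq> B ?n" and cl: "\<And>u z. u \<in> D i \<Longrightarrow> z \<in> B ?n \<Longrightarrow> E u z \<Longrightarrow> z \<in> D i"
    using persist[OF no] by auto
  have Am: "A m = insert (v m) (B ?n)" unfolding mn by (rule A_Suc)
  have vm: "v m \<notin> D i" using persist_notin[OF no] by (simp add: m_def)
  show DK: "D i \<subseteq> K m"
  proof (rule conn_subset_component[OF conn_D])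
    show "D i \<subseteq> A m" using sub unfolding Am by auto
    show "D i \<inter> K m \<noteq> {}" using ov unfolding overlap_def m_def by auto
  qed
  have \<rho>m: "\<rho> m = \<rho> i" unfolding m_def by (rule \<rho>_add)
  have Qm: "Q (A m) (B m) (\<rho> i) (\<rho> (Suc m)) u" if "u \<in> K m" for u
    using Q_component[OF Q_walk that] \<rho>m by simp
  have Qi: "Q (A i) (B i) (\<rho> i) (\<rho> (Suc i)) u" if "u \<in> K i" for u
    by (rule Q_component[OF Q_walk that])
  show iff: "E u (v m) \<longleftrightarrow> E u ?w" if u: "u \<in> D i" for u
  proof -
    have "dg u (A m) = dg u (insert (v m) (D i))"
    proof (rule dg_cong)
      fix y assume "E u y"
      then show "y \<in> A m \<longleftrightarrow> y \<in> insert (v m) (D i)"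
        using cl[OF u, of y] sub unfolding Am by auto
    qed
    moreover have "dg u (A i) = dg u (insert ?w (D i))"
    proof (rule dg_cong)
      fix y assume "E u y"
      then show "y \<in> A i \<longleftrightarrow> y \<in> insert ?w (D i)"
        using u K_closed[of u i y] K_sub[of i] v_Suc(1)[of i] unfolding D_def by auto
    qed
    moreover have "dg u (insert (v m) (D i)) = dg u (D i) + of_bool (E u (v m))"
      by (rule dg_insert[OF vm])
    moreover have "dg u (insert ?w (D i)) = dg u (D i) + of_bool (E u ?w)"
      by (rule dg_insert) (simp add: D_def)
    moreover have "u \<in> K m" "u \<in> K i" using u DK D_sub by auto
    ultimately have "of_bool (E u (v m)) = (of_bool (E u ?w) :: nat)"
      using Q_dg[OF Qm, of u] Q_dg[OF Qi, of u] by simp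
    then show ?thesis by (cases "E u (v m)"; cases "E u ?w") auto
  qed
  have "dg ?w (A i) = dg ?w (D i)"
  proof (rule dg_cong)
    fix y assume y: "E ?w y"
    then have "y \<noteq> ?w" using adj_irrefl by auto
    then show "y \<in> A i \<longleftrightarrow> y \<in> D i"
      using K_closed[OF v_Suc(1) _ y] K_sub[of i] unfolding D_def by auto
  qed
  then have "\<rho> i = dg ?w (D i)" using Q_dg[OF Qi[OF v_Suc(1)]] by simp
  moreover have "{u \<in> D i. E ?w u} = {u \<in> D i. E (v m) u}"
  proof (rule Collect_cong)
    fix u
    show "u \<in> D i \<and> E ?w u \<longleftrightarrow> u \<in> D i \<and> E (v m) u"
      using iff[of u] adj_sym[of u ?w] adj_sym[of ?w u] adj_sym[of u "v m"] adj_sym[of "v m" u]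
      by argo
  qed
  ultimately have "dg (v m) (A m) \<le> card {u \<in> D i. E (v m) u}"
    using Q_dg[OF Qm[OF v_in_K]] by (simp add: dg_def)
  then have "{u \<in> D i. E (v m) u} = {u \<in> A m. E (v m) u}"
    unfolding dg_def by (intro card_seteq) (use DK K_sub[of m] in auto)
  then show "u \<in> D i" if "u \<in> A m" "E (v m) u" for u using that by auto
qed

text \<open>By \<open>first_overlap\<close> the vertex \<open>v (Suc i)\<close>, now on the other
  side, is adjacent to all neighbours of the joker in its own side, so
  \<open>clique_from_twin\<close> applies. Its non-cut hypothesis holds because the last move of the
  joker, made on the other side, led to a non-cut vertex.\<close>

lemma clique_from_overlap:
  assumes no: "\<forall>j'<j. \<not> overlap i j'" and ov: "overlap i j"
    and \<rho>2: "2 \<le> \<rho> i" and w: "v (Suc i) \<in> B (i + 2 * Suc j)"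
  shows "clique V \<and> card V = \<rho> i + \<rho> (Suc i) + 1"
proof -
  let ?n = "Suc i + 2 * j"
  have m: "i + 2 * Suc j = Suc ?n" by simp
  note fo = first_overlap[OF no ov, unfolded m]
  have \<rho>: "\<rho> (Suc ?n) = \<rho> i" "\<rho> (Suc (Suc ?n)) = \<rho> (Suc i)"
    using \<rho>_add[of i "Suc j"] \<rho>_add[of "Suc i" "Suc j"] by simp_all
  have Q: "Q (A (Suc ?n)) (B (Suc ?n)) (\<rho> i) (\<rho> (Suc i)) (v (Suc ?n))"
    using Q_walk[of "Suc ?n"] unfolding \<rho> .
  have An: "insert (v (Suc ?n)) (B (Suc ?n)) = A ?n"
    using v_Suc(1)[of ?n] K_sub[of ?n] unfolding B_Suc by auto
  have "component (A ?n) (v (Suc ?n)) = K ?n"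
    by (rule component_eq[OF v_in_A v_Suc(1)])
  then have nc: "conn (component (insert (v (Suc ?n)) (B (Suc ?n))) (v (Suc ?n)) - {v (Suc ?n)})"
    unfolding An using noncut[of ?n] by simp
  have tw: "E u (v (Suc i))" if "u \<in> A (Suc ?n)" "E (v (Suc ?n)) u" for u
    using fo(2)[OF fo(3)[OF that]] adj_sym[OF that(2)] by simp
  show ?thesis
    by (rule clique_from_twin[OF Q w[unfolded m] \<rho>2 tw nc])
qed

lemma K_edge:
  assumes "\<rho> n = 1" shows "E (v n) (v (Suc n))" "K n = {v n, v (Suc n)}"
proof -
  have "card {y \<in> A n. E (v n) y} = 1" using Q_dg[OF Q_walk[of n]] assms by (simp add: dg_def)
  then obtain q where "{y \<in> A n. E (v n) y} = {q}" by (auto simp: card_1_singleton_iff)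
  then have q: "q \<in> A n" "E (v n) q" "\<And>y. y \<in> A n \<Longrightarrow> E (v n) y \<Longrightarrow> y = q" by auto
  have qK: "q \<in> K n" by (rule K_closed[OF v_in_K q(1,2)])
  then have "card {y \<in> A n. E q y} = 1"
    using Q_dg[OF Q_component[OF Q_walk qK]] assms by (simp add: dg_def)
  then obtain p where "{y \<in> A n. E q y} = {p}" by (auto simp: card_1_singleton_iff)
  moreover have "v n \<in> {y \<in> A n. E q y}" using v_in_A adj_sym[OF q(2)] by simp
  ultimately have p: "y = v n" if "y \<in> A n" "E q y" for y using that by auto
  have "K n \<subseteq> {v n, q}" by (rule component_minimal) (use p q(3) in auto)
  then have "q = v (Suc n)" using v_Suc[of n] by auto
  then show "E (v n) (v (Suc n))" "K n = {v n, v (Suc n)}"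
    using \<open>K n \<subseteq> {v n, q}\<close> qK q(2) v_in_K[of n] by auto
qed

text \<open>By finiteness the joker is at the same vertex at two even times
  \<open>2 * a < 2 * b\<close>. This vertex lies in \<open>D (2 * a)\<close>, because the joker
  moved on to a different one, and in \<open>K (2 * b)\<close>.\<close>

lemma ex_overlap: "\<exists>i j. overlap i j"
proof -
  have "finite (range (\<lambda>k. v (2 * k)))"
  proof (rule finite_subset[OF _ finite_V])
    have "v (2 * k) \<in> V" for k using v_in_A[of "2 * k"] A_sub[of "2 * k"] by auto
    then show "range (\<lambda>k. v (2 * k)) \<subseteq> V" by auto
  qed
  then have "\<not> inj (\<lambda>k. v (2 * k))" using finite_imageD infinite_UNIV_nat by auto
  then obtain a b where ab: "a < b" "v (2 * a) = v (2 * b)"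
    unfolding inj_def by (metis linorder_neqE_nat)
  then have "2 * b = 2 * a + 2 * Suc (b - a - 1)" by simp
  moreover have "v (2 * b) \<in> K (2 * b) \<inter> D (2 * a)"
    using v_in_K[of "2 * b"] v_in_D[of "2 * a"] ab(2) by auto
  ultimately have "overlap (2 * a) (b - a - 1)" unfolding overlap_def by auto
  then show ?thesis by auto
qed

end

section \<open>From the first overlap to a complete graph or an odd cycle\<close>

context finite_graph
begin

definition odd_cycle :: bool where
  "odd_cycle \<longleftrightarrow> (\<exists>n f. 3 \<le> n \<and> odd n \<and> bij_betw f {..<n} V \<and>
    (\<forall>a<n. \<forall>b<n. E (f a) (f b) \<longleftrightarrow> b = Suc a mod n \<or> a = Suc b mod n))"

end

context joker
begin

text \<open>The two neighbours along the cycle exhaust the degree, which excludes chords and edges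
  leaving the cycle; by connectedness the cycle covers \<open>V\<close>.\<close>

lemma odd_cycleI:
  assumes n: "3 \<le> n" "odd n" and inj: "inj_on f {..<n}"
    and adj: "\<And>a. a < n \<Longrightarrow> E (f a) (f (Suc a mod n))"
    and deg: "\<And>a. a < n \<Longrightarrow> dg (f a) V \<le> 2"
  shows odd_cycle
proof -
  define p where "p a = (if a = 0 then n - 1 else a - 1)" for a :: nat
  have p: "p a < n" "Suc (p a) mod n = a" "p a \<noteq> Suc a mod n" if "a < n" for a
    using n that by (auto simp: p_def mod_Suc)
  have p_unique: "b = p a" if "a = Suc b mod n" "b < n" for a b
    using that n by (auto simp: p_def mod_Suc split: if_splits)
  have nbr: "E (f a) y \<longleftrightarrow> y = f (Suc a mod n) \<or> y = f (p a)" if a: "a < n" for a y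
  proof -
    have "f (p a) \<noteq> f (Suc a mod n)"
      using inj_onD[OF inj, of "p a" "Suc a mod n"] p[OF a] n by auto
    then have "card {f (Suc a mod n), f (p a)} = 2" by simp
    moreover have "E (f a) (f (p a))" using adj_sym[OF adj[OF p(1)[OF a]]] p(2)[OF a] by simp
    ultimately have "E (f a) y \<longleftrightarrow> y \<in> {f (Suc a mod n), f (p a)}"
      using deg[OF a] adj[OF a] by (intro nbrs_eq) auto
    then show ?thesis by simp
  qed
  have "f ` {..<n} = V"
  proof (rule closed_eq_V)
    show "f ` {..<n} \<noteq> {}" using n by (simp add: lessThan_empty_iff)
    show "f ` {..<n} \<subseteq> V" using adj_in[OF adj] by auto
    fix x y assume "x \<in> f ` {..<n}" "E x y"
    then obtain a where a: "a < n" "x = f a" by auto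
    then have "y = f (Suc a mod n) \<or> y = f (p a)" using nbr[OF a(1)] \<open>E x y\<close> by simp
    then show "y \<in> f ` {..<n}" using p(1)[OF a(1)] n by auto
  qed
  then have "bij_betw f {..<n} V" using inj by (simp add: bij_betw_def)
  moreover have "E (f a) (f b) \<longleftrightarrow> b = Suc a mod n \<or> a = Suc b mod n" if ab: "a < n" "b < n" for a b
  proof -
    have "f b = f (Suc a mod n) \<longleftrightarrow> b = Suc a mod n" "f b = f (p a) \<longleftrightarrow> b = p a"
      using inj_onD[OF inj, of b] ab n p(1)[OF ab(1)] by auto
    then show ?thesis using nbr[OF ab(1)] p_unique[of a b] p(2)[OF ab(1)] ab by auto
  qed
  ultimately show ?thesis unfolding odd_cycle_def using n by blast
qed

end

context joker_walk
begin

text \<open>This puts the twin on the other side, as \<open>clique_from_overlap\<close> requires: it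
  belongs to the remainder \<open>D (Suc i)\<close>, which has not been overlapped yet.\<close>

lemma v_Suc_in_B:
  assumes "\<forall>j'<j. \<not> overlap (Suc i) j'"
  shows "v (Suc i) \<in> B (i + 2 * Suc j)"
  using persist[OF assms] v_in_D[of "Suc i"] by auto

lemma clique_or_odd_cycle:
  "(clique V \<and> card V = \<rho> 0 + \<rho> 1 + 1) \<or> (\<rho> 0 = 1 \<and> \<rho> 1 = 1 \<and> odd_cycle)"
proof -
  define W where "W m \<longleftrightarrow> (\<exists>i j. m = i + 2 * Suc j \<and> overlap i j)" for m
  \<comment> \<open>The least time at which any remainder is overlapped; before it
    \<open>persist\<close> applies to every remainder.\<close>
  define m where "m = (LEAST m. W m)"
  have "\<exists>m. W m" using ex_overlap unfolding W_def by auto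
  then have "W m" unfolding m_def by (rule LeastI_ex)
  then obtain i j where m: "m = i + 2 * Suc j" and ov: "overlap i j" unfolding W_def by auto
  have "\<not> W m'" if "m' < m" for m' using that not_less_Least unfolding m_def by blast
  then have least: "\<not> overlap i' j'" if "i' + 2 * Suc j' < m" for i' j'
    using that unfolding W_def by blast
  have no: "\<forall>j'<j. \<not> overlap i j'" using least m by simp
  have noS: "\<forall>j'<j. \<not> overlap (Suc i) j'" using least m by simp
  have w: "v (Suc i) \<in> B m" using v_Suc_in_B[OF noS] m by simp
  have \<rho>01: "\<rho> i + \<rho> (Suc i) = \<rho> 0 + \<rho> 1" for i
    by (induction i) (simp_all add: \<rho>_period)
  have \<rho>m: "\<rho> m = \<rho> i" unfolding m by (rule \<rho>_add)
  note fo = first_overlap[OF no ov, folded m]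
  show ?thesis
  proof (cases "2 \<le> \<rho> i")
    case True
    have "clique V \<and> card V = \<rho> i + \<rho> (Suc i) + 1"
      by (rule clique_from_overlap[OF no ov True]) (use w m in simp)
    then show ?thesis using \<rho>01[of i] by simp
  next
    case False
    then have \<rho>1: "\<rho> i = 1" "\<rho> m = 1" using \<rho>_pos[of i] \<rho>m by auto
    \<comment> \<open>\<open>q\<close> is the only neighbour of the joker on its side, hence by
      \<open>first_overlap\<close> it lies in \<open>D i\<close> and is adjacent to
      \<open>v (Suc i)\<close>.\<close>
    define q where "q = v (Suc m)"
    have Km: "K m = {v m, q}" "E (v m) q" using K_edge[OF \<rho>1(2)] by (simp_all add: q_def)
    have vmD: "v m \<notin> D i" using persist_notin[OF no] m by simp
    have qD: "q \<in> D i" using fo(3)[of q] Km K_sub[of m] by auto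
    have qw: "E q (v (Suc i))" using fo(2)[OF qD] adj_sym[OF Km(2)] by simp
    show ?thesis
    proof (cases "2 \<le> \<rho> (Suc i)")
      case True
      \<comment> \<open>The joker goes on to \<open>q\<close>, whose neighbour
        \<open>v (Suc i)\<close> lies in \<open>D (Suc i)\<close>. So one step later there is an
        overlap on the other side as well, now with degree at least 2, and the twin there is
        \<open>v (Suc (Suc i))\<close>.\<close>
      have "v (Suc i) \<in> K (Suc m)"
        by (rule K_closed[OF v_in_K]) (use w qw in \<open>simp_all add: A_Suc q_def\<close>)
      then have ovS: "overlap (Suc i) j"
        unfolding overlap_def using v_in_D[of "Suc i"] m by auto
      have "v (Suc (Suc i)) \<in> A m \<and> v (Suc (Suc i)) \<noteq> q"
      proof (cases j)
        case 0
        then have "v (Suc (Suc i)) = v m" by (simp add: m)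
        then show ?thesis using v_in_A[of m] vmD qD by auto
      next
        case (Suc j0)
        have "\<forall>j'<j0. \<not> overlap (Suc (Suc i)) j'" using least m Suc by simp
        from persist[OF this] have "v (Suc (Suc i)) \<in> B (Suc (Suc (Suc i)) + 2 * j0)"
          using v_in_D[of "Suc (Suc i)"] by auto
        moreover have "m = Suc (Suc (Suc (Suc i)) + 2 * j0)" using m Suc by simp
        ultimately have "v (Suc (Suc i)) \<in> A m" by (simp add: A_Suc)
        moreover have "\<not> overlap i 0" using no Suc by simp
        ultimately show ?thesis
          unfolding overlap_def using qD v_in_K[of "Suc (Suc i)"] by auto
      qed
      then have "v (Suc (Suc i)) \<in> B (Suc i + 2 * Suc j)" using m by (simp add: B_Suc q_def)
      from clique_from_overlap[OF noS ovS True this] show ?thesis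
        using \<rho>01[of "Suc i"] by simp
    next
      case False
      then have \<rho>S: "\<rho> (Suc i) = 1" using \<rho>_pos[of "Suc i"] by simp
      then have \<rho>s: "\<rho> 0 = 1" "\<rho> 1 = 1" using \<rho>01[of i] \<rho>1 \<rho>_pos[of 0] \<rho>_pos[of 1] by simp_all
      have \<rho>n: "\<rho> n = 1" for n
        using \<rho>01[of n] \<rho>s \<rho>_pos[of n] \<rho>_pos[of "Suc n"] by simp
      have adj: "E (v n) (v (Suc n))" for n using K_edge(1)[OF \<rho>n] .
      have Kn: "K n = {v n, v (Suc n)}" for n using K_edge(2)[OF \<rho>n] .
      have deg: "dg (v n) V \<le> 2" for n using Q_dgV[OF Q_walk[of n]] \<rho>n by simp
      have "D i = {v i}" unfolding D_def Kn using v_Suc(2)[of i] by auto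
      then have q: "v (Suc m) = v i" using qD by (simp add: q_def)
      \<comment> \<open>Otherwise \<open>v i\<close> would have the three distinct neighbours
        \<open>v (i - 1)\<close>, \<open>v (i + 1)\<close> and \<open>v m\<close>, against its
        degree bound 2. So the walk closes up at its very start.\<close>
      have i0: "i = 0"
      proof (cases i)
        case (Suc i')
        have "v i' \<in> B (Suc i')" using v_in_A[of i'] v_Suc(2)[of i'] by (auto simp: B_Suc)
        then have ne1: "v i' \<noteq> v (Suc i)"
          using v_Suc(1)[of i] K_sub[of i] A_B_disj[of i] Suc by auto
        have ne2: "v m \<noteq> v (Suc i)" using w v_in_A[of m] A_B_disj[of m] by auto
        have "\<not> overlap i' j" using least m Suc by simp
        moreover have "v m \<in> K (i' + 2 * Suc j)" using Kn[of "i' + 2 * Suc j"] m Suc by simp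
        ultimately have ne3: "v m \<noteq> v i'"
          unfolding overlap_def using v_in_D[of i'] by auto
        have c3: "card {v i', v (Suc i), v m} = 3" using ne1 ne2 ne3 by simp
        have sub: "{v i', v (Suc i), v m} \<subseteq> {y \<in> V. E (v i) y}"
          using adj[of i] adj_sym[OF adj[of i']] adj_sym[OF adj[of m]] adj_in[OF adj] Suc q
          by auto
        have "card {y \<in> V. E (v i) y} \<le> 2" using deg[of i] by (simp add: dg_def)
        then show ?thesis using card_mono[OF finite_nbrs sub] c3 by simp
      qed simp
      \<comment> \<open>At even distance the earlier vertex lies in a remainder that the later one
        avoids; at odd distance the two lie on opposite sides.\<close>
      have ne: "v a \<noteq> v b" if ab: "a < b" "b \<le> m" for a b
      proof (cases "even (b - a)")
        case True
        then obtain k where k: "b - a = 2 * k" by (rule evenE)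
        define j' where "j' = k - 1"
        have b: "b = a + 2 * Suc j'" using k ab by (auto simp: j'_def)
        have "\<forall>l<j'. \<not> overlap a l" using least b ab by simp
        from persist_notin[OF this] show ?thesis using v_in_D[of a] b by auto
      next
        case False
        then obtain k where k: "b - a = 2 * k + 1" by (rule oddE)
        then have b: "b = Suc a + 2 * k" using ab by simp
        have "\<forall>l<k. \<not> overlap a l" using least b ab by simp
        from persist[OF this] have "v a \<in> B b" using v_in_D[of a] b by auto
        then show ?thesis using v_in_A[of b] A_B_disj[of b] by auto
      qed
      have odd_cycle
      proof (rule odd_cycleI)
        show "3 \<le> Suc m" "odd (Suc m)" using m i0 by simp_all
        show "inj_on v {..<Suc m}"
        proof (rule inj_onI)
          fix a b assume "a \<in> {..<Suc m}" "b \<in> {..<Suc m}" "v a = v b"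
          then show "a = b" using ne[of a b] ne[of b a] by (cases a b rule: linorder_cases) auto
        qed
        show "E (v a) (v (Suc a mod Suc m))" if "a < Suc m" for a
          using adj[of a] q i0 that by (cases "a = m") auto
        show "dg (v a) V \<le> 2" for a by (rule deg)
      qed
      then show ?thesis using \<rho>s by simp
    qed
  qed
qed

end

context joker
begin

lemma ex_next:
  assumes Q: "Q A B r s x" and "1 \<le> r"
  shows "\<exists>y. y \<in> component A x \<and> y \<noteq> x \<and> conn (component A x - {y}) \<and>
    Q (insert y B) (A - {y}) s r y"
proof -
  have xA: "x \<in> A" by (rule Q_mem[OF Q])
  have sub: "component A x \<subseteq> A" by (rule component_subset[OF xA])
  have "finite A" using Q_sub[OF Q] finite_V finite_subset by auto
  then have fin: "finite (component A x)" using sub finite_subset by auto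
  have "card {y \<in> A. E x y} \<noteq> 0" using Q_dg[OF Q] assms(2) by (simp add: dg_def)
  then have "{y \<in> A. E x y} \<noteq> {}" by auto
  then obtain z where z: "z \<in> A" "E x z" by auto
  have "z \<in> component A x" by (rule component.step[OF component.base z])
  moreover have "z \<noteq> x" using z adj_irrefl by auto
  ultimately have "component A x \<noteq> {x}" by auto
  from ex_noncut_vertex[OF fin conn_component[OF xA] component.base this]
  obtain y where y: "y \<in> component A x" "y \<noteq> x" "conn (component A x - {y})" by auto
  then show ?thesis using Q_flip[OF Q_component[OF Q y(1)]] by auto
qed

theorem joker_clique_or_odd_cycle:
  assumes Q: "Q A B r s x" and r: "1 \<le> r" and s: "1 \<le> s"
  shows "(clique V \<and> card V = r + s + 1) \<or> (r = 1 \<and> s = 1 \<and> odd_cycle)"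
proof -
  define \<rho> where "\<rho> n = (if even n then r else s)" for n :: nat
  define P where "P n t = (case t of (A, B, x) \<Rightarrow> Q A B (\<rho> n) (\<rho> (Suc n)) x)" for n t
  \<comment> \<open>A state of the walk is a triple of the two sides and the joker; \<open>R\<close>
    collects the step conditions of \<open>joker_walk\<close> in a form fit for dependent
    choice.\<close>
  define R where "R t t' \<longleftrightarrow>
    snd (snd t') \<in> component (fst t) (snd (snd t)) \<and> snd (snd t') \<noteq> snd (snd t) \<and>
    conn (component (fst t) (snd (snd t)) - {snd (snd t')}) \<and>
    fst t' = insert (snd (snd t')) (fst (snd t)) \<and> fst (snd t') = fst t - {snd (snd t')}"
    for t t' :: "'a set \<times> 'a set \<times> 'a"
  have \<rho>: "1 \<le> \<rho> n" "\<rho> (Suc (Suc n)) = \<rho> n" for n using r s by (simp_all add: \<rho>_def)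
  have "\<exists>t'. P (Suc n) t' \<and> R t t'" if "P n t" for n t
  proof -
    obtain A B x where t: "t = (A, B, x)" by (cases t)
    with that have "Q A B (\<rho> n) (\<rho> (Suc n)) x" by (simp add: P_def)
    from ex_next[OF this \<rho>(1)] obtain y where y: "y \<in> component A x" "y \<noteq> x"
      "conn (component A x - {y})" "Q (insert y B) (A - {y}) (\<rho> (Suc n)) (\<rho> n) y" by auto
    then have "P (Suc n) (insert y B, A - {y}, y) \<and> R t (insert y B, A - {y}, y)"
      using \<rho>(2)[of n] unfolding P_def R_def t by simp
    then show ?thesis by (rule exI)
  qed
  moreover have "\<exists>t. P 0 t" by (rule exI[of _ "(A, B, x)"]) (use Q in \<open>simp add: P_def \<rho>_def\<close>)
  ultimately have "\<exists>t. \<forall>n. P n (t n) \<and> R (t n) (t (Suc n))"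
    by (intro dependent_nat_choice)
  then obtain t where "\<forall>n. P n (t n) \<and> R (t n) (t (Suc n))" ..
  then have t: "\<And>n. P n (t n)" "\<And>n. R (t n) (t (Suc n))" by simp_all
  interpret joker_walk V E Q "\<lambda>n. fst (t n)" "\<lambda>n. fst (snd (t n))" "\<lambda>n. snd (snd (t n))" \<rho>
  proof
    fix n
    show "Q (fst (t n)) (fst (snd (t n))) (\<rho> n) (\<rho> (Suc n)) (snd (snd (t n)))"
      using t(1)[of n] by (simp add: P_def split: prod.splits)
  qed (use \<rho> t(2) in \<open>simp_all add: R_def\<close>)
  show ?thesis using clique_or_odd_cycle by (simp add: \<rho>_def)
qed

end

section \<open>Free sets, colourings and exchanges\<close>

definition free :: "'a set set \<Rightarrow> 'a set \<Rightarrow> bool" where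
  "free C W \<longleftrightarrow> \<not> (\<exists>S\<in>C. S \<subseteq> W)"

definition colourable :: "'i set \<Rightarrow> ('i \<Rightarrow> 'a set set) \<Rightarrow> 'a set \<Rightarrow> bool" where
  "colourable I C W \<longleftrightarrow>
    (\<exists>c. (\<forall>u\<in>W. c u \<in> I) \<and> (\<forall>i\<in>I. free (C i) {u \<in> W. c u = i}))"

lemma free_mono: "free C W \<Longrightarrow> U \<subseteq> W \<Longrightarrow> free C U"
  by (auto simp: free_def)

context finite_graph
begin

text \<open>Abstracts the vertex sets of copies of a connected graph of minimum degree
  \<open>d\<close>. Here \<open>dg y S\<close> counts neighbours in the host graph, so
  \<open>d\<close> is only a lower bound.\<close>

definition copies :: "'a set set \<Rightarrow> nat \<Rightarrow> bool" where
  "copies C d \<longleftrightarrow> (\<forall>S\<in>C. S \<noteq> {} \<and> conn S \<and> (\<forall>y\<in>S. d \<le> dg y S))"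

lemma dg_insert_self [simp]: "dg x (insert x A) = dg x A"
  by (rule dg_cong) (use adj_irrefl in auto)

lemma dg_remove_self [simp]: "dg x (A - {x}) = dg x A"
  by (rule dg_cong) (use adj_irrefl in auto)

text \<open>A forbidden set created by adding \<open>x\<close> contains \<open>x\<close> and hence
  \<open>d\<close> of its neighbours. If \<open>W\<close> offers exactly \<open>d\<close>, all of
  them are in it, so deleting any one destroys it.\<close>

lemma free_insert:
  assumes C: "copies C d" and W: "free C W" and S: "S \<in> C" "S \<subseteq> insert x W"
  shows "x \<in> S" "d \<le> dg x W"
    and "dg x W = d \<Longrightarrow> y \<in> W \<Longrightarrow> E x y \<Longrightarrow> y \<in> S"
proof -
  show xS: "x \<in> S" using W S by (auto simp: free_def)
  have dS: "d \<le> dg x S" using C S(1) xS by (simp add: copies_def)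
  have sub: "dg x S \<le> dg x W" using dg_mono[OF S(2), of x] by simp
  show "d \<le> dg x W" using dS sub by simp
  show "y \<in> S" if "dg x W = d" "y \<in> W" "E x y"
  proof -
    have "{z \<in> S. E x z} \<subseteq> {z \<in> W. E x z}" using S(2) adj_irrefl[of x] by auto
    moreover have "card {z \<in> W. E x z} \<le> card {z \<in> S. E x z}"
      using dS that(1) by (simp add: dg_def)
    ultimately have "{z \<in> S. E x z} = {z \<in> W. E x z}" by (intro card_seteq) simp_all
    then show ?thesis using that by auto
  qed
qed

text \<open>The common property of being free for one graph and of being colourable for the others,
  which lets both sides be treated alike.\<close>

definition swappable :: "('a set \<Rightarrow> bool) \<Rightarrow> nat \<Rightarrow> bool" where
  "swappable F d \<longleftrightarrow> F {} \<and>
    (\<forall>W x. F W \<longrightarrow> x \<notin> W \<longrightarrow> \<not> F (insert x W) \<longrightarrow> d \<le> dg x W \<and>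
      (dg x W = d \<longrightarrow> (\<forall>y\<in>W. E x y \<longrightarrow> F (insert x W - {y}))))"

lemma swappable_free:
  assumes C: "copies C d" shows "swappable (free C) d"
  unfolding swappable_def
proof (intro conjI allI impI ballI)
  show "free C {}" using C by (auto simp: free_def copies_def)
  fix W x assume W: "free C W" and "x \<notin> W" and "\<not> free C (insert x W)"
  then obtain S where S: "S \<in> C" "S \<subseteq> insert x W" by (auto simp: free_def)
  show "d \<le> dg x W" by (rule free_insert(2)[OF C W S])
  fix y assume y: "dg x W = d" "y \<in> W" "E x y"
  show "free C (insert x W - {y})" unfolding free_def
  proof
    assume "\<exists>S\<in>C. S \<subseteq> insert x W - {y}"
    then obtain S where S: "S \<in> C" "S \<subseteq> insert x W - {y}" by auto
    then have "S \<subseteq> insert x W" by auto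
    then show False using free_insert(3)[OF C W S(1) _ y] S(2) by auto
  qed
qed

lemma dg_colours:
  assumes "finite I" "\<forall>u\<in>W. c u \<in> I"
  shows "dg x W = (\<Sum>i\<in>I. dg x {u \<in> W. c u = i})"
proof -
  have "{y \<in> W. E x y} = (\<Union>i\<in>I. {y \<in> {u \<in> W. c u = i}. E x y})" using assms(2) by auto
  moreover have "card (\<Union>i\<in>I. {y \<in> {u \<in> W. c u = i}. E x y}) =
      (\<Sum>i\<in>I. card {y \<in> {u \<in> W. c u = i}. E x y})"
  proof (rule card_UN_disjoint[OF assms(1)])
    show "\<forall>i\<in>I. finite {y \<in> {u \<in> W. c u = i}. E x y}" using finite_nbrs by (intro ballI)
  qed auto
  ultimately show ?thesis by (simp add: dg_def)
qed

text \<open>If \<open>x\<close> fitted into a class, \<open>insert x W\<close> would be colourable.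
  So each class \<open>i\<close> is blocked by at least \<open>d i\<close> neighbours of
  \<open>x\<close>; if the sum of these bounds is attained, so is each of them.\<close>

lemma not_colourable_insert:
  assumes I: "finite I" and C: "\<forall>i\<in>I. copies (C i) (d i)"
    and c: "\<forall>u\<in>W. c u \<in> I" "\<forall>i\<in>I. free (C i) {u \<in> W. c u = i}"
    and x: "x \<notin> W" "\<not> colourable I C (insert x W)"
  shows "\<And>i. i \<in> I \<Longrightarrow> \<not> free (C i) (insert x {u \<in> W. c u = i})"
    and "(\<Sum>i\<in>I. d i) \<le> dg x W"
    and "\<And>i. dg x W = (\<Sum>i\<in>I. d i) \<Longrightarrow> i \<in> I \<Longrightarrow> dg x {u \<in> W. c u = i} = d i"
proof -
  show nf: "\<not> free (C i) (insert x {u \<in> W. c u = i})" if i: "i \<in> I" for i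
  proof
    assume f: "free (C i) (insert x {u \<in> W. c u = i})"
    have "{u \<in> insert x W. (c(x := i)) u = j} =
      (if j = i then insert x {u \<in> W. c u = i} else {u \<in> W. c u = j})" for j
      using x(1) by auto
    then have "colourable I C (insert x W)"
      unfolding colourable_def using c i f by (intro exI[of _ "c(x := i)"]) simp
    then show False using x(2) by simp
  qed
  have le: "d i \<le> dg x {u \<in> W. c u = i}" if i: "i \<in> I" for i
  proof -
    obtain S where "S \<in> C i" "S \<subseteq> insert x {u \<in> W. c u = i}" using nf[OF i] by (auto simp: free_def)
    then show ?thesis using free_insert(2)[OF bspec[OF C i] bspec[OF c(2) i]] by simp
  qed
  show "(\<Sum>i\<in>I. d i) \<le> dg x W" unfolding dg_colours[OF I c(1)] by (rule sum_mono) (rule le)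
  show "dg x {u \<in> W. c u = i} = d i" if "dg x W = (\<Sum>i\<in>I. d i)" "i \<in> I" for i
    using sum_mono_inv[of d I "\<lambda>i. dg x {u \<in> W. c u = i}" i] that dg_colours[OF I c(1), of x] le I
    by simp
qed

lemma swappable_colourable:
  assumes I: "finite I" and C: "\<forall>i\<in>I. copies (C i) (d i)"
  shows "swappable (colourable I C) (\<Sum>i\<in>I. d i)"
  unfolding swappable_def
proof (intro conjI allI impI ballI)
  have "free (C i) {}" if "i \<in> I" for i using bspec[OF C that] by (auto simp: free_def copies_def)
  then show "colourable I C {}" by (simp add: colourable_def)
  fix W x assume "colourable I C W" and x: "x \<notin> W" "\<not> colourable I C (insert x W)"
  then obtain c where c: "\<forall>u\<in>W. c u \<in> I" "\<forall>i\<in>I. free (C i) {u \<in> W. c u = i}"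
    by (auto simp: colourable_def)
  note nci = not_colourable_insert[OF I C c x]
  show "(\<Sum>i\<in>I. d i) \<le> dg x W" by (rule nci(2))
  fix y assume y: "dg x W = (\<Sum>i\<in>I. d i)" "y \<in> W" "E x y"
  \<comment> \<open>\<open>x\<close> takes over the colour of \<open>y\<close>; only this class
    changes, and there it is an exchange as in \<open>swappable_free\<close>.\<close>
  define i where "i = c y"
  have i: "i \<in> I" using c(1) y(2) by (simp add: i_def)
  let ?W = "{u \<in> W. c u = i}"
  have fi: "free (C i) (insert x ?W - {y})"
  proof -
    have "free (C i) ?W" using c(2) i by simp
    moreover have "x \<notin> ?W" "y \<in> ?W" using x(1) y(2) by (simp_all add: i_def)
    ultimately show ?thesis
      using swappable_free[OF bspec[OF C i]] nci(1)[OF i] nci(3)[OF y(1) i] y(3)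
      unfolding swappable_def by simp
  qed
  have "free (C j) {u \<in> insert x W - {y}. (c(x := i)) u = j}" if j: "j \<in> I" for j
  proof (cases "j = i")
    case True
    have "{u \<in> insert x W - {y}. (c(x := i)) u = i} \<subseteq> insert x ?W - {y}" using x(1) by auto
    then show ?thesis unfolding True by (rule free_mono[OF fi])
  next
    case False
    have "free (C j) {u \<in> W. c u = j}" using c(2) j by simp
    then show ?thesis by (rule free_mono) (use x(1) False in auto)
  qed
  moreover have "(c(x := i)) u \<in> I" if "u \<in> insert x W - {y}" for u using c(1) i that by auto
  ultimately show "colourable I C (insert x W - {y})"
    unfolding colourable_def by (intro exI[of _ "c(x := i)"] conjI ballI)
qed

section \<open>Extremal pairs of sides and the abstract partition theorem\<close>

lemma ex_max_card:
  assumes "P {}" shows "\<exists>U. (U \<subseteq> V \<and> P U) \<and> (\<forall>T. T \<subseteq> V \<and> P T \<longrightarrow> card T \<le> card U)"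
proof (rule ex_has_greatest_nat)
  show "{} \<subseteq> V \<and> P {}" using assms by simp
  show "\<forall>T. T \<subseteq> V \<and> P T \<longrightarrow> card T < Suc (card V)"
    using card_mono[OF finite_V] by (auto simp: less_Suc_eq_le)
qed

text \<open>Choose \<open>U\<close> as large as possible subject to \<open>F\<close>, and then \<open>W\<close> as large as possible subject
  to \<open>P\<close>. Any vertex left over is a joker.\<close>

lemma max_pair:
  assumes F: "swappable F a" and P: "swappable P b"
    and deg: "\<And>x. x \<in> V \<Longrightarrow> dg x V \<le> a + b"
    and conn_V: "conn V" and ab: "1 \<le> a" "1 \<le> b"
  obtains U W where "U \<inter> W = {}" "U \<union> W \<subseteq> V" "F U" "P W"
    "\<And>T. T \<subseteq> V \<Longrightarrow> F T \<Longrightarrow> card T \<le> card U"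
    "\<And>x. x \<in> V - (U \<union> W) \<Longrightarrow> \<not> F (insert x U) \<and> \<not> P (insert x W) \<and> dg x U = a \<and> dg x W = b \<and>
      (\<forall>y\<in>U. E x y \<longrightarrow> dg y (insert x U) = a) \<and> (\<forall>y\<in>W. E x y \<longrightarrow> dg y (insert x W) = b) \<and>
      ((clique V \<and> card V = a + b + 1) \<or> (a = 1 \<and> b = 1 \<and> odd_cycle))"
proof -
  obtain U where U: "U \<subseteq> V" "F U" and maxU: "\<And>T. T \<subseteq> V \<Longrightarrow> F T \<Longrightarrow> card T \<le> card U"
    using ex_max_card[of F] F unfolding swappable_def by auto
  \<comment> \<open>The set realizing the maximum of \<open>F\<close> is left open here: exchanges
    alter it, so \<open>W\<close> has to be largest over all choices of it.\<close>
  define R where "R W \<longleftrightarrow> (\<exists>U'\<subseteq>V. F U' \<and> card U' = card U \<and> U' \<inter> W = {} \<and> P W)" for W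
  have "R {}" unfolding R_def using U P unfolding swappable_def by auto
  from ex_max_card[of R, OF this] obtain W
    where W: "W \<subseteq> V" "R W" and maxW: "\<And>T. T \<subseteq> V \<Longrightarrow> R T \<Longrightarrow> card T \<le> card W" by auto
  define L where "L X Y \<longleftrightarrow> X \<inter> Y = {} \<and> X \<union> Y \<subseteq> V \<and> F X \<and> P Y \<and>
    card X = card U \<and> card Y = card W" for X Y
  have fin: "finite X" if "X \<subseteq> V" for X using that finite_V finite_subset by auto
  \<comment> \<open>Adding \<open>x\<close> to either side would beat one of the maxima, so both are
    blocked; the degree bound then makes both neighbour counts exact, and every exchange gives
    another extremal pair.\<close>
  have L: "\<not> F (insert x X) \<and> \<not> P (insert x Y) \<and> dg x X = a \<and> dg x Y = b \<and>
      (\<forall>y\<in>X. E x y \<longrightarrow> L (insert x X - {y}) Y) \<and> (\<forall>y\<in>Y. E x y \<longrightarrow> L X (insert x Y - {y}))"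
    if L: "L X Y" and x: "x \<in> V" "x \<notin> X" "x \<notin> Y" for X Y x
  proof -
    have XY: "X \<inter> Y = {}" "X \<union> Y \<subseteq> V" "F X" "P Y" "card X = card U" "card Y = card W"
      "X \<subseteq> V" "Y \<subseteq> V" using L by (auto simp: L_def)
    have nF: "\<not> F (insert x X)"
    proof
      assume "F (insert x X)"
      then have "card (insert x X) \<le> card U" using maxU XY x by simp
      then show False using XY(5) x fin[OF XY(7)] by simp
    qed
    have nP: "\<not> P (insert x Y)"
    proof
      assume "P (insert x Y)"
      then have "R (insert x Y)" unfolding R_def using XY x by (intro exI[of _ X]) simp
      then have "card (insert x Y) \<le> card W" using maxW XY x by simp
      then show False using XY(6) x fin[OF XY(8)] by simp
    qed
    have Fx: "a \<le> dg x X" "dg x X = a \<Longrightarrow> \<forall>y\<in>X. E x y \<longrightarrow> F (insert x X - {y})"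
      using F XY(3) x nF unfolding swappable_def by simp_all
    have Px: "b \<le> dg x Y" "dg x Y = b \<Longrightarrow> \<forall>y\<in>Y. E x y \<longrightarrow> P (insert x Y - {y})"
      using P XY(4) x nP unfolding swappable_def by simp_all
    have "dg x X + dg x Y \<le> a + b"
      using dg_Un[OF XY(1), of x] dg_mono[OF XY(2), of x] deg[OF x(1)] by simp
    then have dgs: "dg x X = a" "dg x Y = b" using Fx(1) Px(1) by simp_all
    have "L (insert x X - {y}) Y" if y: "y \<in> X" "E x y" for y
    proof -
      have "y \<noteq> x" using y x by auto
      then have "card (insert x X - {y}) = card X" using y x fin[OF XY(7)] by simp
      then show ?thesis using Fx(2)[OF dgs(1)] y XY x by (auto simp: L_def)
    qed
    moreover have "L X (insert x Y - {y})" if y: "y \<in> Y" "E x y" for y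
    proof -
      have "y \<noteq> x" using y x by auto
      then have "card (insert x Y - {y}) = card Y" using y x fin[OF XY(8)] by simp
      then show ?thesis using Px(2)[OF dgs(2)] y XY x by (auto simp: L_def)
    qed
    ultimately show ?thesis using nF nP dgs by simp
  qed
  define Q where "Q A B r s x \<longleftrightarrow> x \<in> V \<and> x \<in> A \<and> x \<notin> B \<and>
    ((r = a \<and> s = b \<and> L (A - {x}) B) \<or> (r = b \<and> s = a \<and> L B (A - {x})))" for A B r s x
  interpret joker V E Q
  proof
    fix A B r s x
    assume Q: "Q A B r s x"
    show "x \<in> A" using Q by (simp add: Q_def)
    show "A \<inter> B = {}" "A \<union> B \<subseteq> V" using Q by (auto simp: Q_def L_def)
    show "dg x A = r" using Q L[of "A - {x}" B x] L[of B "A - {x}" x] by (auto simp: Q_def)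
    show "dg x V \<le> r + s" using Q deg[of x] by (auto simp: Q_def)
    show "Q (insert x B) (A - {x}) s r x" using Q by (auto simp: Q_def)
    fix y assume y: "y \<in> A" "E x y"
    then have "y \<noteq> x" using adj_irrefl by auto
    have eq: "insert x A = A" using Q by (auto simp: Q_def)
    have yB: "y \<notin> B" "y \<in> V" using \<open>A \<inter> B = {}\<close> y adj_in by auto
    consider "r = a" "s = b" "L (A - {x}) B" | "r = b" "s = a" "L B (A - {x})"
      using Q unfolding Q_def by auto
    then show "Q A B r s y"
    proof cases
      case 1
      then have "L (A - {y}) B"
        using L[of "A - {x}" B x] Q y \<open>y \<noteq> x\<close> by (auto simp: Q_def eq)
      then show ?thesis using 1 y yB by (simp add: Q_def)
    next
      case 2
      then have "L B (A - {y})"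
        using L[of B "A - {x}" x] Q y \<open>y \<noteq> x\<close> by (auto simp: Q_def eq)
      then show ?thesis using 2 y yB by (simp add: Q_def)
    qed
  qed (rule conn_V)
  \<comment> \<open>The original \<open>U\<close> need not be disjoint from \<open>W\<close>; the
    witness \<open>U'\<close> of \<open>R W\<close> is, and has the same size.\<close>
  obtain U' where "U' \<subseteq> V" "F U'" "card U' = card U" "U' \<inter> W = {}" "P W"
    using W(2) unfolding R_def by auto
  then have LW: "L U' W" using W(1) by (simp add: L_def)
  show ?thesis
  proof (rule that[of U' W])
    show "U' \<inter> W = {}" "U' \<union> W \<subseteq> V" "F U'" "P W" using LW by (auto simp: L_def)
    show "card T \<le> card U'" if "T \<subseteq> V" "F T" for T
      using maxU[OF that] LW by (simp add: L_def)
    fix x assume "x \<in> V - (U' \<union> W)"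
    then have x: "x \<in> V" "x \<notin> U'" "x \<notin> W" by auto
    have Q1: "Q (insert x U') W a b x" and Q2: "Q (insert x W) U' b a x"
      using LW x by (simp_all add: Q_def)
    have "\<forall>y\<in>U'. E x y \<longrightarrow> dg y (insert x U') = a" using Q_dg[OF Q_step[OF Q1]] by simp
    moreover have "\<forall>y\<in>W. E x y \<longrightarrow> dg y (insert x W) = b" using Q_dg[OF Q_step[OF Q2]] by simp
    ultimately show "\<not> F (insert x U') \<and> \<not> P (insert x W) \<and> dg x U' = a \<and> dg x W = b \<and>
      (\<forall>y\<in>U'. E x y \<longrightarrow> dg y (insert x U') = a) \<and> (\<forall>y\<in>W. E x y \<longrightarrow> dg y (insert x W) = b) \<and>
      ((clique V \<and> card V = a + b + 1) \<or> (a = 1 \<and> b = 1 \<and> odd_cycle))"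
      using L[OF LW x] joker_clique_or_odd_cycle[OF Q1 ab] by simp
  qed
qed

text \<open>In a clique \<open>x\<close> is adjacent to all of \<open>X\<close>, so
  \<open>insert x X\<close> has just \<open>dg x X + 1\<close> vertices. This bound later makes the
  forbidden graphs complete.\<close>

lemma small_copy_in_clique:
  assumes "clique V" "x \<in> V" "X \<subseteq> V" "x \<notin> X" "S \<subseteq> insert x X"
  shows "card S \<le> dg x X + 1"
proof -
  have fin: "finite X" using assms(3) finite_V finite_subset by auto
  have "E x y" if "y \<in> X" for y
  proof -
    have "y \<in> V" "x \<noteq> y" using that assms(3,4) by auto
    then show ?thesis using assms(1,2) by (simp add: clique_def)
  qed
  then have "{y \<in> X. E x y} = X" by auto
  then have "dg x X = card X" by (simp add: dg_def)
  moreover have "card S \<le> card (insert x X)" using assms(5) fin by (intro card_mono) simp_all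
  ultimately show ?thesis using assms(4) fin by simp
qed

text \<open>\<open>x\<close> and its one neighbour form a component of \<open>insert x X\<close>,
  which holds the connected set \<open>S\<close>.\<close>

lemma small_copy_in_edge:
  assumes "dg x X = 1" "\<forall>y\<in>X. E x y \<longrightarrow> dg y (insert x X) = 1"
    and "conn S" "x \<in> S" "S \<subseteq> insert x X"
  shows "card S \<le> 2"
proof -
  obtain y where y: "{z \<in> X. E x z} = {y}"
    using assms(1) by (auto simp: dg_def card_1_singleton_iff)
  then have yX: "y \<in> X" "E x y" by auto
  then have "card {z \<in> insert x X. E y z} = 1" using assms(2) by (simp add: dg_def)
  then obtain t where t: "{z \<in> insert x X. E y z} = {t}" by (auto simp: card_1_singleton_iff)
  have "x \<in> {z \<in> insert x X. E y z}" using adj_sym[OF yX(2)] by simp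
  then have tx: "t = x" using t by auto
  have "S \<subseteq> {x, y}"
  proof (rule conn_subset_closed[OF assms(3)])
    show "S \<inter> {x, y} \<noteq> {}" using assms(4) by auto
    fix u z assume uz: "u \<in> S" "u \<in> {x, y}" "z \<in> S" "E u z"
    show "z \<in> {x, y}"
    proof (cases "u = x")
      case True
      then have "z \<in> {z \<in> X. E x z}" using uz assms(5) adj_irrefl by auto
      then show ?thesis using y by auto
    next
      case False
      then have "z \<in> {z \<in> insert x X. E y z}" using uz assms(5) by auto
      then show ?thesis using t tx by auto
    qed
  qed
  then have "card S \<le> card {x, y}" by (intro card_mono) simp_all
  also have "\<dots> \<le> 2" by (simp add: card_insert_if)
  finally show ?thesis .
qed

text \<open>The maximum side serves \<open>i0\<close> and the other side all remaining colours. If a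
  vertex is left over, forbidden sets of every colour arise by adding it, and the structure of
  \<open>V\<close> bounds their sizes.\<close>

theorem partition_or_exception:
  assumes I: "finite I" "i0 \<in> I" "I - {i0} \<noteq> {}"
    and C: "\<forall>i\<in>I. copies (C i) (d i)" and d: "\<forall>i\<in>I. 1 \<le> d i"
    and deg: "\<forall>x\<in>V. dg x V \<le> (\<Sum>i\<in>I. d i)" and conn_V: "conn V"
  shows "(\<exists>c. (\<forall>u\<in>V. c u \<in> I) \<and> (\<forall>i\<in>I. free (C i) {u \<in> V. c u = i}) \<and>
      (\<forall>T\<subseteq>V. free (C i0) T \<longrightarrow> card T \<le> card {u \<in> V. c u = i0})) \<or>
    (\<forall>i\<in>I. \<exists>S\<in>C i. card S \<le> d i + 1) \<and>
      (clique V \<and> card V = (\<Sum>i\<in>I. d i) + 1 \<or> (\<forall>i\<in>I. d i = 1) \<and> odd_cycle)"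
proof -
  define J where "J = I - {i0}"
  define b where "b = (\<Sum>i\<in>J. d i)"
  have finJ: "finite J" and IJ: "I = insert i0 J" "i0 \<notin> J" using I by (auto simp: J_def)
  have CJ: "\<forall>i\<in>J. copies (C i) (d i)" using C IJ by simp
  have C0: "copies (C i0) (d i0)" using C I by simp
  have sum: "(\<Sum>i\<in>I. d i) = d i0 + b" using IJ finJ by (simp add: b_def)
  have cardJ: "card J \<le> b"
    using sum_bounded_below[of J 1 d] d IJ by (simp add: b_def)
  have "J \<noteq> {}" unfolding J_def by (rule I(3))
  then have J0: "card J \<noteq> 0" using finJ by simp
  with cardJ have b1: "1 \<le> b" by linarith
  have a1: "1 \<le> d i0" using d I by simp
  obtain U W where UW: "U \<inter> W = {}" "U \<union> W \<subseteq> V" "free (C i0) U" "colourable J C W"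
    and maxU: "\<And>T. T \<subseteq> V \<Longrightarrow> free (C i0) T \<Longrightarrow> card T \<le> card U"
    and left: "\<And>x. x \<in> V - (U \<union> W) \<Longrightarrow> \<not> free (C i0) (insert x U) \<and>
      \<not> colourable J C (insert x W) \<and> dg x U = d i0 \<and> dg x W = b \<and>
      (\<forall>y\<in>U. E x y \<longrightarrow> dg y (insert x U) = d i0) \<and> (\<forall>y\<in>W. E x y \<longrightarrow> dg y (insert x W) = b) \<and>
      ((clique V \<and> card V = d i0 + b + 1) \<or> (d i0 = 1 \<and> b = 1 \<and> odd_cycle))"
    using max_pair[OF swappable_free[OF C0] swappable_colourable[OF finJ CJ], folded b_def]
      deg conn_V a1 b1 unfolding sum by blast
  obtain c where c: "\<forall>u\<in>W. c u \<in> J" "\<forall>i\<in>J. free (C i) {u \<in> W. c u = i}"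
    using UW(4) by (auto simp: colourable_def)
  show ?thesis
  proof (cases "V - (U \<union> W) = {}")
    case True
    then have V: "V = U \<union> W" using UW(2) by auto
    define c' where "c' u = (if u \<in> U then i0 else c u)" for u
    have cU: "{u \<in> V. c' u = i0} = U" using c(1) IJ(2) by (auto simp: c'_def V)
    have cW: "{u \<in> V. c' u = i} = {u \<in> W. c u = i}" if "i \<in> J" for i
      using that IJ(2) UW(1) by (auto simp: c'_def V)
    have "\<forall>u\<in>V. c' u \<in> I" using c(1) IJ V by (auto simp: c'_def)
    moreover have "\<forall>i\<in>I. free (C i) {u \<in> V. c' u = i}"
      using c(2) cU cW UW(3) unfolding IJ(1) by simp
    moreover have "\<forall>T\<subseteq>V. free (C i0) T \<longrightarrow> card T \<le> card {u \<in> V. c' u = i0}"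
      using maxU cU by simp
    ultimately show ?thesis by (intro disjI1 exI[of _ c'] conjI)
  next
    case False
    then obtain x where "x \<in> V - (U \<union> W)" by auto
    then have x: "x \<in> V" "x \<notin> U" "x \<notin> W" and
      nU: "\<not> free (C i0) (insert x U)" and nW: "\<not> colourable J C (insert x W)" and
      dU: "dg x U = d i0" and dW: "dg x W = b" and
      rU: "\<forall>y\<in>U. E x y \<longrightarrow> dg y (insert x U) = d i0" and
      rW: "\<forall>y\<in>W. E x y \<longrightarrow> dg y (insert x W) = b" and
      alt: "(clique V \<and> card V = d i0 + b + 1) \<or> (d i0 = 1 \<and> b = 1 \<and> odd_cycle)"
      using left by auto
    note nci = not_colourable_insert[OF finJ CJ c x(3) nW, folded b_def]
    obtain S0 where S0: "S0 \<in> C i0" "S0 \<subseteq> insert x U" using nU by (auto simp: free_def)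
    have "\<exists>S. S \<in> C i \<and> S \<subseteq> insert x {u \<in> W. c u = i}" if "i \<in> J" for i
      using nci(1)[OF that] by (auto simp: free_def)
    then obtain S where S: "\<And>i. i \<in> J \<Longrightarrow> S i \<in> C i" "\<And>i. i \<in> J \<Longrightarrow> S i \<subseteq> insert x {u \<in> W. c u = i}"
      by metis
    have small: "\<forall>i\<in>I. \<exists>S\<in>C i. card S \<le> d i + 1" if "card S0 \<le> d i0 + 1"
      "\<And>i. i \<in> J \<Longrightarrow> card (S i) \<le> d i + 1" using that S0(1) S(1) unfolding IJ(1) by auto
    from alt show ?thesis
    proof
      assume cl: "clique V \<and> card V = d i0 + b + 1"
      have "card S0 \<le> d i0 + 1"
        using small_copy_in_clique[of x U S0] cl x UW(2) S0(2) dU by simp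
      moreover have "card (S i) \<le> d i + 1" if i: "i \<in> J" for i
      proof -
        have "{u \<in> W. c u = i} \<subseteq> V" using UW(2) by auto
        then show ?thesis
          using small_copy_in_clique[of x "{u \<in> W. c u = i}" "S i"] cl x S(2)[OF i] nci(3)[OF dW i]
          by simp
      qed
      ultimately show ?thesis using small cl sum by simp
    next
      assume odd: "d i0 = 1 \<and> b = 1 \<and> odd_cycle"
      \<comment> \<open>Every \<open>d i\<close> is at least 1, so \<open>b = 1\<close> leaves a
        single further colour.\<close>
      have "card J = 1" using cardJ odd J0 by simp
      then obtain j where j: "J = {j}" by (auto simp: card_1_singleton_iff)
      have dj: "d j = 1" using odd by (simp add: b_def j)
      have Cj: "copies (C j) (d j)" and jJ: "j \<in> J" using CJ j by simp_all
      have "conn S0" using C0 S0(1) by (simp add: copies_def)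
      then have "card S0 \<le> 2"
        using small_copy_in_edge[of x U S0] odd dU rU S0(2) free_insert(1)[OF C0 UW(3) S0] by simp
      moreover have "card (S j) \<le> 2"
      proof (rule small_copy_in_edge[of x W])
        show "dg x W = 1" "\<forall>y\<in>W. E x y \<longrightarrow> dg y (insert x W) = 1" using dW rW odd by simp_all
        show "conn (S j)" using Cj S(1)[OF jJ] by (simp add: copies_def)
        have "free (C j) {u \<in> W. c u = j}" using c(2) jJ by simp
        then show "x \<in> S j" by (rule free_insert(1)[OF Cj _ S(1)[OF jJ] S(2)[OF jJ]])
        show "S j \<subseteq> insert x W" using S(2)[OF jJ] by auto
      qed
      ultimately have "\<forall>i\<in>I. \<exists>S\<in>C i. card S \<le> d i + 1" using odd dj by (intro small) (simp_all add: j)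
      then show ?thesis using odd dj IJ(1) by (simp add: j)
    qed
  qed
qed

end

section \<open>From symmetric digraphs to adjacency relations\<close>

lemma (in graph) finite_graph_adj: "finite_graph (verts G) (\<lambda>x y. x \<rightarrow>\<^bsub>G\<^esub> y)"
proof
  show "finite (verts G)" by simp
  show "x \<in> verts G \<and> y \<in> verts G" if "x \<rightarrow>\<^bsub>G\<^esub> y" for x y using adj_in_verts[OF that] by simp
  show "y \<rightarrow>\<^bsub>G\<^esub> x" if "x \<rightarrow>\<^bsub>G\<^esub> y" for x y using arcs_ends_symmetric[OF sym_arcs that] .
  show "\<not> x \<rightarrow>\<^bsub>G\<^esub> x" for x using adj_not_same by auto
qed

lemma (in nomulti_digraph) out_degree_eq_card: "out_degree G x = card {y. x \<rightarrow>\<^bsub>G\<^esub> y}"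
proof -
  have "inj_on (head G) (out_arcs G x)"
    by (rule inj_onI) (auto intro: no_multi_arcs simp: arc_to_ends_def)
  moreover have "head G ` out_arcs G x = {y. x \<rightarrow>\<^bsub>G\<^esub> y}"
    by (auto simp: arcs_ends_conv)
  ultimately show ?thesis unfolding out_degree_def using card_image by fastforce
qed

lemma (in fin_digraph) min_degree_le: "v \<in> verts G \<Longrightarrow> min_degree G \<le> out_degree G v"
  by (simp add: min_degree_def)

lemma (in fin_digraph) max_degree_ge: "v \<in> verts G \<Longrightarrow> out_degree G v \<le> max_degree G"
  by (simp add: max_degree_def)

lemma (in graph) conn_verts:
  assumes "connected G" shows "finite_graph.conn (\<lambda>x y. x \<rightarrow>\<^bsub>G\<^esub> y) (verts G)"
proof -
  interpret finite_graph "verts G" "\<lambda>x y. x \<rightarrow>\<^bsub>G\<^esub> y" by (rule finite_graph_adj)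
  have sc: "strongly_connected G"
    by (rule symmetric_connected_imp_strongly_connected[OF sym_arcs assms])
  show ?thesis unfolding conn_def
  proof (intro allI impI, rule ccontr)
    fix T assume T: "T \<noteq> {} \<and> T \<subset> verts G"
      and "\<not> (\<exists>u\<in>T. \<exists>z\<in>verts G - T. u \<rightarrow>\<^bsub>G\<^esub> z)"
    then have cl: "z \<in> T" if "u \<in> T" "u \<rightarrow>\<^bsub>G\<^esub> z" for u z
      using that adj_in_verts(2)[OF that(2)] by auto
    obtain u z where uz: "u \<in> T" "z \<in> verts G" "z \<notin> T" using T by auto
    then have "u \<rightarrow>\<^sup>*\<^bsub>G\<^esub> z" using sc T by (auto simp: strongly_connected_def)
    then have "z \<in> T" by (induction rule: reachable_induct) (use uz(1) cl in auto)
    then show False using uz(3) by simp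
  qed
qed

lemma (in graph) two_le_card_min_degree:
  assumes "connected G" "2 \<le> card (verts G)"
  shows "1 \<le> min_degree G"
proof -
  interpret finite_graph "verts G" "\<lambda>x y. x \<rightarrow>\<^bsub>G\<^esub> y" by (rule finite_graph_adj)
  have ne: "verts G \<noteq> {}" using assms(2) by auto
  have "1 \<le> out_degree G v" if v: "v \<in> verts G" for v
  proof -
    have "card {v} \<noteq> card (verts G)" using assms(2) by simp
    then have "{v} \<noteq> verts G" by metis
    then have "{v} \<subset> verts G" using v by auto
    from connD[OF conn_verts[OF assms(1)] _ this] obtain y where y: "v \<rightarrow>\<^bsub>G\<^esub> y" by auto
    have "finite {y. v \<rightarrow>\<^bsub>G\<^esub> y}"
      by (rule finite_subset[OF _ finite_verts]) (auto dest: adj_in_verts)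
    then have "card {y. v \<rightarrow>\<^bsub>G\<^esub> y} \<noteq> 0" using y by auto
    then show ?thesis unfolding out_degree_eq_card by simp
  qed
  then show ?thesis unfolding min_degree_def using ne by (intro Min.boundedI) auto
qed

text \<open>A vertex has at least \<open>min_degree G\<close> neighbours, and at most that many
  other vertices exist, so it is adjacent to all of them.\<close>

lemma (in graph) complete_if_card_le:
  assumes "verts G \<noteq> {}" "card (verts G) \<le> min_degree G + 1"
  shows "K\<^bsub>min_degree G + 1\<^esub> G"
proof -
  have nbr: "{y. v \<rightarrow>\<^bsub>G\<^esub> y} = verts G - {v}" "min_degree G + 1 \<le> card (verts G)" if v: "v \<in> verts G" for v
  proof -
    have sub: "{y. v \<rightarrow>\<^bsub>G\<^esub> y} \<subseteq> verts G - {v}" using adj_not_same by (auto dest: adj_in_verts)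
    have le: "min_degree G \<le> card {y. v \<rightarrow>\<^bsub>G\<^esub> y}"
      using min_degree_le[OF v] by (simp add: out_degree_eq_card)
    have card: "card (verts G - {v}) = card (verts G) - 1" using v by simp
    show "{y. v \<rightarrow>\<^bsub>G\<^esub> y} = verts G - {v}"
      by (rule card_seteq[OF _ sub]) (use le card assms(2) in auto)
    then have "min_degree G \<le> card (verts G) - 1" using le card by simp
    moreover have "card (verts G) \<noteq> 0" using assms(1) by simp
    ultimately show "min_degree G + 1 \<le> card (verts G)" by linarith
  qed
  have "card (verts G) = min_degree G + 1" using nbr(2) assms by (auto intro: antisym)
  moreover have "arcs_ends G = {(u, v). (u, v) \<in> verts G \<times> verts G \<and> u \<noteq> v}"
    using nbr(1) by (auto dest: adj_in_verts adj_not_same)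
  ultimately show ?thesis unfolding complete_digraph_def by (simp add: graph_axioms)
qed

definition copy_verts :: "('b, 'c) pre_digraph \<Rightarrow> ('a, 'd) pre_digraph \<Rightarrow> 'a set set" where
  "copy_verts G H = verts ` {S. subgraph S H \<and> digraph_iso S G}"

text \<open>Inducing on \<open>W\<close> removes only arcs with an end outside \<open>W\<close>, so
  a subgraph survives exactly when its vertices lie in \<open>W\<close>; hence only the vertex sets
  of copies matter.\<close>

lemma (in wf_digraph) subgraph_free_iff:
  assumes "W \<subseteq> verts G"
  shows "subgraph_free F (G \<restriction> W) \<longleftrightarrow> free (copy_verts F G) W"
proof -
  have ind: "subgraph (G \<restriction> W) G"
    using assms wf_digraph by (auto simp: subgraph_def compatible_def)
  have "subgraph S (G \<restriction> W) \<longleftrightarrow> subgraph S G \<and> verts S \<subseteq> W" for S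
  proof
    assume S: "subgraph S (G \<restriction> W)"
    show "subgraph S G \<and> verts S \<subseteq> W"
      using subgraph_trans[OF S ind] S by (auto simp: subgraph_def)
  next
    assume S: "subgraph S G \<and> verts S \<subseteq> W"
    have "tail G e \<in> W \<and> head G e \<in> W" if "e \<in> arcs S" for e
    proof -
      interpret S: wf_digraph S using S by (auto simp: subgraph_def)
      have "tail S = tail G" "head S = head G" using S by (auto simp: subgraph_def compatible_def)
      then show ?thesis using S.tail_in_verts[OF that] S.head_in_verts[OF that] S by auto
    qed
    then show "subgraph S (G \<restriction> W)" using S ind by (auto simp: subgraph_def compatible_def)
  qed
  then show ?thesis by (auto simp: subgraph_free_def free_def copy_verts_def)
qed

lemma copy_props:
  assumes H: "graph H" and G: "graph G" and S: "subgraph S H" and iso: "digraph_iso S G"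
  shows "card (verts S) = card (verts G)"
    and "\<And>y. y \<in> verts S \<Longrightarrow> min_degree G \<le> out_degree S y"
    and "\<And>y. y \<in> verts S \<Longrightarrow> out_degree S y \<le> card {z \<in> verts S. y \<rightarrow>\<^bsub>H\<^esub> z}"
    and "connected G \<Longrightarrow> finite_graph.conn (\<lambda>x y. x \<rightarrow>\<^bsub>H\<^esub> y) (verts S)"
proof -
  interpret H: graph H by (rule H)
  interpret G: graph G by (rule G)
  interpret S: digraph S by (rule H.digraph_subgraph[OF S])
  obtain f where f: "S.digraph_isomorphism f" and Gf: "G = app_iso f S"
    using iso unfolding digraph_iso_def by auto
  have inj: "inj_on (iso_verts f) (verts S)" by (rule S.digraph_isomorphism_inj_on_verts[OF f])
  have vG: "verts G = iso_verts f ` verts S" using Gf by simp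
  show "card (verts S) = card (verts G)" unfolding vG by (rule card_image[OF inj, symmetric])
  show "min_degree G \<le> out_degree S y" if y: "y \<in> verts S" for y
    using G.min_degree_le[of "iso_verts f y"] S.out_degree_app_iso_eq[OF f y] y
    unfolding Gf by simp
  have adj: "y \<rightarrow>\<^bsub>S\<^esub> z \<Longrightarrow> y \<rightarrow>\<^bsub>H\<^esub> z" for y z
    using S by (auto simp: subgraph_def compatible_def arcs_ends_conv)
  show "out_degree S y \<le> card {z \<in> verts S. y \<rightarrow>\<^bsub>H\<^esub> z}" for y
    unfolding S.out_degree_eq_card
    by (rule card_mono) (auto dest: S.adj_in_verts adj)
  assume con: "connected G"
  interpret fH: finite_graph "verts H" "\<lambda>x y. x \<rightarrow>\<^bsub>H\<^esub> y" by (rule H.finite_graph_adj)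
  interpret fG: finite_graph "verts G" "\<lambda>x y. x \<rightarrow>\<^bsub>G\<^esub> y" by (rule G.finite_graph_adj)
  show "fH.conn (verts S)" unfolding fH.conn_def
  proof (intro allI impI)
    fix T assume T: "T \<noteq> {} \<and> T \<subset> verts S"
    \<comment> \<open>The isomorphism carries a cut of \<open>S\<close> to a cut of
      \<open>G\<close>; the crossing arc found there is the image of an arc of \<open>S\<close>,
      which crosses in the same direction.\<close>
    then have "iso_verts f ` T \<noteq> {}" "iso_verts f ` T \<subset> verts G"
      unfolding vG using inj inj_on_image_eq_iff[OF inj, of T "verts S"] by auto
    from fG.connD[OF G.conn_verts[OF con] this] obtain u' z'
      where u'z': "u' \<in> iso_verts f ` T" "z' \<notin> iso_verts f ` T" "u' \<rightarrow>\<^bsub>G\<^esub> z'" by auto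
    from u'z'(3) obtain e where "e \<in> arcs G" "tail G e = u'" "head G e = z'" by auto
    then obtain a where a: "a \<in> arcs S" "iso_verts f (tail S a) = u'" "iso_verts f (head S a) = z'"
      unfolding Gf using S.iso_verts_tail[OF f] S.iso_verts_head[OF f] by auto
    have t: "tail S a \<in> T"
    proof -
      obtain u where u: "u \<in> T" "u' = iso_verts f u" using u'z'(1) by auto
      then have "u = tail S a" using inj_onD[OF inj, of u "tail S a"] a T by auto
      then show ?thesis using u by simp
    qed
    have h: "head S a \<in> verts S - T" using a u'z'(2) by auto
    have "tail S a \<rightarrow>\<^bsub>S\<^esub> head S a" using a(1) by (auto simp: arcs_ends_conv)
    then have "tail S a \<rightarrow>\<^bsub>H\<^esub> head S a" by (rule adj)
    then show "\<exists>u\<in>T. \<exists>z\<in>verts S - T. u \<rightarrow>\<^bsub>H\<^esub> z" using t h by auto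
  qed
qed

lemma copies_copy_verts:
  assumes H: "graph H" and G: "graph G" "connected G" and ne: "verts G \<noteq> {}"
  shows "finite_graph.copies (\<lambda>x y. x \<rightarrow>\<^bsub>H\<^esub> y) (copy_verts G H) (min_degree G)"
proof -
  interpret H: graph H by (rule H)
  interpret fH: finite_graph "verts H" "\<lambda>x y. x \<rightarrow>\<^bsub>H\<^esub> y" by (rule H.finite_graph_adj)
  show ?thesis unfolding fH.copies_def
  proof
    fix X assume "X \<in> copy_verts G H"
    then obtain S where S: "subgraph S H" "digraph_iso S G" and X: "X = verts S"
      by (auto simp: copy_verts_def)
    note p = copy_props[OF H G(1) S, folded X]
    interpret G: graph G by (rule G(1))
    have "X \<noteq> {}" using p(1) ne by (metis G.finite_verts card_0_eq card.empty)
    moreover have "min_degree G \<le> fH.dg y X" if "y \<in> X" for y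
      unfolding fH.dg_def using p(2,3)[OF that] by simp
    ultimately show "X \<noteq> {} \<and> fH.conn X \<and> (\<forall>y\<in>X. min_degree G \<le> fH.dg y X)"
      using p(4)[OF G(2)] by simp
  qed
qed

text \<open>Every vertex already has at least \<open>max_degree H\<close> arcs in \<open>S\<close>,
  so no arc of \<open>H\<close> is missing and \<open>S = H\<close>.\<close>

lemma spanning_copy_iso:
  assumes H: "graph H" and G: "graph G" and S: "subgraph S H" "digraph_iso S G"
    and span: "verts S = verts H" and deg: "max_degree H \<le> min_degree G"
  shows "digraph_iso H G"
proof -
  interpret H: graph H by (rule H)
  have th: "tail S = tail H" "head S = head H" and sub: "arcs S \<subseteq> arcs H"
    using S(1) by (auto simp: subgraph_def compatible_def)
  have "arcs H \<subseteq> arcs S"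
  proof
    fix e assume e: "e \<in> arcs H"
    define v where "v = tail H e"
    have v: "v \<in> verts H" using e by (simp add: v_def)
    have "out_degree H v \<le> out_degree S v"
      using copy_props(2)[OF H G S, of v] H.max_degree_ge[OF v] deg v span by simp
    moreover have "out_arcs S v \<subseteq> out_arcs H v" using sub th by auto
    ultimately have "out_arcs S v = out_arcs H v"
      unfolding out_degree_def by (intro card_seteq) auto
    then show "e \<in> arcs S" using e by (auto simp: v_def)
  qed
  then have "S = H" using sub th span by (intro pre_digraph.equality) auto
  then show ?thesis using S(2) by simp
qed

lemma is_odd_cycleI:
  assumes H: "graph H" and odd: "finite_graph.odd_cycle (verts H) (\<lambda>x y. x \<rightarrow>\<^bsub>H\<^esub> y)"
  shows "is_odd_cycle H"
proof -
  interpret H: graph H by (rule H)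
  interpret fH: finite_graph "verts H" "\<lambda>x y. x \<rightarrow>\<^bsub>H\<^esub> y" by (rule H.finite_graph_adj)
  obtain n f where n: "3 \<le> n" "odd n" and f: "bij_betw f {..<n} (verts H)"
    and adj: "\<And>a b. a < n \<Longrightarrow> b < n \<Longrightarrow> f a \<rightarrow>\<^bsub>H\<^esub> f b \<longleftrightarrow> b = Suc a mod n \<or> a = Suc b mod n"
    using odd unfolding fH.odd_cycle_def by auto
  define g where "g = inv_into {..<n} f"
  have g: "bij_betw g (verts H) {..<n}" unfolding g_def by (rule bij_betw_inv_into[OF f])
  have gf: "g (f a) = a" if "a < n" for a
    using that f unfolding g_def by (simp add: bij_betw_def inv_into_f_f)
  have fg: "f (g x) = x" "g x < n" if "x \<in> verts H" for x
    using that f g unfolding g_def by (auto simp: bij_betw_inv_into_right bij_betw_def)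
  define h where "h = \<lparr> iso_verts = g, iso_arcs = (\<lambda>e. (g (tail H e), g (head H e))),
    iso_head = snd, iso_tail = fst \<rparr>"
  have "H.digraph_isomorphism h"
    unfolding H.digraph_isomorphism_def
  proof (intro conjI ballI)
    show "wf_digraph H" by (rule H.wf_digraph)
    show "inj_on (iso_verts h) (verts H)" using g by (simp add: h_def bij_betw_def)
    show "inj_on (iso_arcs h) (arcs H)"
    proof (rule inj_onI)
      fix x y assume xy: "x \<in> arcs H" "y \<in> arcs H" "iso_arcs h x = iso_arcs h y"
      then have "f (g (tail H x)) = f (g (tail H y))" "f (g (head H x)) = f (g (head H y))"
        by (simp_all add: h_def)
      then have "tail H x = tail H y" "head H x = head H y" using fg xy by simp_all
      then show "x = y" using H.no_multi_arcs xy by (simp add: arc_to_ends_def)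
    qed
  qed (simp_all add: h_def)
  moreover have "with_proj (cycle_graph n) = app_iso h H"
  proof (rule pre_digraph.equality)
    show "verts (with_proj (cycle_graph n)) = verts (app_iso h H)"
      using g by (simp add: h_def cycle_graph_def bij_betw_def)
    show "arcs (with_proj (cycle_graph n)) = arcs (app_iso h H)"
    proof (intro set_eqI iffI)
      fix p assume "p \<in> arcs (with_proj (cycle_graph n))"
      then obtain a b where ab: "p = (a, b)" "a < n" "b < n" "b = Suc a mod n \<or> a = Suc b mod n"
        by (auto simp: cycle_graph_def)
      then have "f a \<rightarrow>\<^bsub>H\<^esub> f b" using adj by simp
      then obtain e where "e \<in> arcs H" "tail H e = f a" "head H e = f b" by auto
      then show "p \<in> arcs (app_iso h H)"
        using ab gf by (auto simp: h_def intro!: rev_image_eqI)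
    next
      fix p assume "p \<in> arcs (app_iso h H)"
      then obtain e where e: "e \<in> arcs H" "p = (g (tail H e), g (head H e))" by (auto simp: h_def)
      then have "tail H e \<rightarrow>\<^bsub>H\<^esub> head H e" by (auto simp: arcs_ends_conv)
      then show "p \<in> arcs (with_proj (cycle_graph n))"
        using e adj[of "g (tail H e)" "g (head H e)"] fg by (auto simp: cycle_graph_def)
    qed
  qed (simp_all add: h_def)
  ultimately have "digraph_iso H (with_proj (cycle_graph n))" unfolding digraph_iso_def by auto
  then show ?thesis unfolding is_odd_cycle_def using n by auto
qed

section \<open>The case \<open>k = 1\<close> and the exclusion of the exceptions\<close>

theorem theorem1:
  fixes k :: nat
    and G :: "nat \<Rightarrow> ('b, 'c) pre_digraph"
    and H :: "('a, 'd) pre_digraph"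
  assumes "k \<ge> 1"
    and "\<And>i. i \<in> {1..k} \<Longrightarrow> Digraph.graph (G i)"
    and "\<And>i. i \<in> {1..k} \<Longrightarrow> Digraph_Component.connected (G i)"
    and "\<And>i. i \<in> {1..k} \<Longrightarrow> card (verts (G i)) \<ge> 2"
    and "Digraph.graph H"
    and "Digraph_Component.connected H"
    and "max_degree H = (\<Sum>i\<in>{1..k}. min_degree (G i))"
    and "k = 1 \<Longrightarrow> \<not> digraph_iso H (G 1)"
    and "(\<forall>i\<in>{1..k}. K\<^bsub>min_degree (G i) + 1\<^esub> (G i)) \<Longrightarrow> \<not> K\<^bsub>max_degree H + 1\<^esub> H"
    and "(\<forall>i\<in>{1..k}. K\<^bsub>2\<^esub> (G i)) \<Longrightarrow> \<not> is_odd_cycle H \<and> \<not> (\<exists>n. K\<^bsub>n\<^esub> H)"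
  shows "\<exists>V :: nat \<Rightarrow> 'a set.
    disjoint_family_on V {1..k} \<and> (\<Union>i\<in>{1..k}. V i) = verts H \<and>
    (\<forall>i\<in>{1..k}. subgraph_free (G i) (H \<restriction> V i)) \<and>
    (\<exists>i\<in>{1..k}. max_induced_free (G i) H (V i))"
proof -
  interpret H: graph H by (rule assms(5))
  interpret finite_graph "verts H" "\<lambda>x y. x \<rightarrow>\<^bsub>H\<^esub> y" by (rule H.finite_graph_adj)
  let ?I = "{1..k}"
  define C where "C i = copy_verts (G i) H" for i
  define d where "d i = min_degree (G i)" for i
  have one: "1 \<in> ?I" using assms(1) by simp
  have neG: "verts (G i) \<noteq> {}" if "i \<in> ?I" for i using assms(4)[OF that] by auto
  have C: "\<forall>i\<in>?I. copies (C i) (d i)"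
    unfolding C_def d_def using copies_copy_verts[OF assms(5) assms(2,3) neG] by simp
  have d1: "\<forall>i\<in>?I. 1 \<le> d i"
    unfolding d_def using graph.two_le_card_min_degree[OF assms(2-4)] by simp
  have free_iff: "subgraph_free (G i) (H \<restriction> W) \<longleftrightarrow> free (C i) W" if "W \<subseteq> verts H" for i W
    unfolding C_def by (rule H.subgraph_free_iff[OF that])
  have dg_deg: "dg x (verts H) = out_degree H x" for x
    unfolding dg_def H.out_degree_eq_card
    by (rule arg_cong[where f = card]) (auto dest: H.adj_in_verts)
  have sum_d: "(\<Sum>i\<in>?I. d i) = max_degree H" unfolding d_def using assms(7) by simp
  have deg: "\<forall>x\<in>verts H. dg x (verts H) \<le> (\<Sum>i\<in>?I. d i)"
    unfolding dg_deg sum_d using H.max_degree_ge by simp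
  have conn_H: "conn (verts H)" by (rule H.conn_verts[OF assms(6)])
  have result: ?thesis if c: "\<forall>u\<in>verts H. c u \<in> ?I" "\<forall>i\<in>?I. free (C i) {u \<in> verts H. c u = i}"
    "\<forall>T\<subseteq>verts H. free (C 1) T \<longrightarrow> card T \<le> card {u \<in> verts H. c u = 1}" for c :: "'a \<Rightarrow> nat"
  proof (rule exI[of _ "\<lambda>i. {u \<in> verts H. c u = i}"], intro conjI)
    show "disjoint_family_on (\<lambda>i. {u \<in> verts H. c u = i}) ?I"
      by (auto simp: disjoint_family_on_def)
    show "(\<Union>i\<in>?I. {u \<in> verts H. c u = i}) = verts H" using c(1) by auto
    show "\<forall>i\<in>?I. subgraph_free (G i) (H \<restriction> {u \<in> verts H. c u = i})"
      using c(2) free_iff by simp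
    have "max_induced_free (G 1) H {u \<in> verts H. c u = 1}"
      unfolding max_induced_free_def using c(2,3) free_iff assms(1) by auto
    then show "\<exists>i\<in>?I. max_induced_free (G i) H {u \<in> verts H. c u = i}"
      using assms(1) by (intro bexI[of _ 1]) simp_all
  qed
  show ?thesis
  proof (cases "k = 1")
    case True
    have sum1: "max_degree H = d 1" using sum_d True by simp
    have d_1: "\<forall>x\<in>verts H. dg x (verts H) \<le> d 1" using deg unfolding sum_d sum1 .
    \<comment> \<open>There is no second side here. A copy of \<open>G 1\<close> uses up the degrees
      of its vertices, so no edge leaves it and it spans the connected \<open>H\<close>;
      \<open>spanning_copy_iso\<close> then contradicts the hypothesis for
      \<open>k = 1\<close>.\<close>
    have "free (C 1) (verts H)" unfolding free_def
    proof
      assume "\<exists>X\<in>C 1. X \<subseteq> verts H"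
      then obtain S where S: "subgraph S H" "digraph_iso S (G 1)" and SC: "verts S \<in> C 1"
        by (auto simp: C_def copy_verts_def)
      have G1: "graph (G 1)" by (rule assms(2)[OF one])
      have sub: "verts S \<subseteq> verts H" using S(1) by (auto simp: subgraph_def)
      have cS: "verts S \<noteq> {}" "\<And>y. y \<in> verts S \<Longrightarrow> d 1 \<le> dg y (verts S)"
        using bspec[OF C one] SC by (simp_all add: copies_def)
      have "verts H \<subseteq> verts S"
      proof (rule conn_subset_closed[OF conn_H])
        show "verts H \<inter> verts S \<noteq> {}" using cS(1) sub by auto
        fix u z assume u: "u \<in> verts H" "u \<in> verts S" and z: "z \<in> verts H" "u \<rightarrow>\<^bsub>H\<^esub> z"
        have "card {y \<in> verts H. u \<rightarrow>\<^bsub>H\<^esub> y} \<le> card {y \<in> verts S. u \<rightarrow>\<^bsub>H\<^esub> y}"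
          using cS(2)[OF u(2)] bspec[OF d_1 u(1)] by (simp add: dg_def)
        moreover have "{y \<in> verts S. u \<rightarrow>\<^bsub>H\<^esub> y} \<subseteq> {y \<in> verts H. u \<rightarrow>\<^bsub>H\<^esub> y}" using sub by auto
        ultimately have "{y \<in> verts S. u \<rightarrow>\<^bsub>H\<^esub> y} = {y \<in> verts H. u \<rightarrow>\<^bsub>H\<^esub> y}"
          by (intro card_seteq) simp_all
        then show "z \<in> verts S" using z by auto
      qed
      then have "verts S = verts H" using sub by (rule equalityI[rotated])
      then have "digraph_iso H (G 1)"
        using spanning_copy_iso[OF assms(5) G1 S] sum1 by (simp add: d_def)
      then show False using assms(8) True by simp
    qed
    then show ?thesis
      using True by (intro result[of "\<lambda>_. 1"]) (auto intro!: card_mono)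
  next
    case False
    have ne: "?I - {1} \<noteq> {}" using False assms(1) by auto
    from partition_or_exception[OF finite_atLeastAtMost one ne C d1 deg conn_H] show ?thesis
    proof (rule disjE, goal_cases)
      case 1
      then show ?thesis using result by auto
    next
      case 2
      then have small: "\<forall>i\<in>?I. \<exists>X\<in>C i. card X \<le> d i + 1"
        and alt: "clique (verts H) \<and> card (verts H) = (\<Sum>i\<in>?I. d i) + 1 \<or>
          (\<forall>i\<in>?I. d i = 1) \<and> odd_cycle" by auto
      \<comment> \<open>A copy with at most \<open>d i + 1\<close> vertices gives \<open>G i\<close>
        the smallest order that its minimum degree permits, so it is complete.\<close>
      have K: "K\<^bsub>d i + 1\<^esub> (G i)" if i: "i \<in> ?I" for i
      proof -
        obtain S where S: "subgraph S H" "digraph_iso S (G i)" and card: "card (verts S) \<le> d i + 1"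
          using bspec[OF small i] by (auto simp: C_def copy_verts_def)
        then have "card (verts (G i)) \<le> d i + 1"
          using copy_props(1)[OF assms(5) assms(2)[OF i] S] by simp
        then show ?thesis
          unfolding d_def by (intro graph.complete_if_card_le[OF assms(2)[OF i] neG[OF i]])
      qed
      from alt show ?thesis
      proof
        assume cl: "clique (verts H) \<and> card (verts H) = (\<Sum>i\<in>?I. d i) + 1"
        then have "arcs_ends H = {(u, v). (u, v) \<in> verts H \<times> verts H \<and> u \<noteq> v}"
          unfolding clique_def by (auto dest: H.adj_in_verts H.adj_not_same)
        then have "K\<^bsub>max_degree H + 1\<^esub> H"
          unfolding complete_digraph_def using cl assms(5) sum_d by simp
        then show ?thesis using assms(9) K by (auto simp: d_def)
      next
        assume odd: "(\<forall>i\<in>?I. d i = 1) \<and> odd_cycle"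
        then have "is_odd_cycle H" using is_odd_cycleI[OF assms(5)] by simp
        moreover have "K\<^bsub>2\<^esub> (G i)" if "i \<in> ?I" for i using K[OF that] odd that by (simp add: numeral_2_eq_2)
        ultimately show ?thesis using assms(10) by auto
      qed
    qed
  qed
qed

end
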